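(* Let $\mathbf{w}\in\mathcal{W}$ and $1\le p<\infty$. The space $g(\mathbf{w},p)$ is complementably homogeneous and uniformly complementably $\ell_p$-saturated.
   Context: $\mathbb{F}$ is the real or complex field. $\mathcal{W}$ is the set of sequences $\mathbf{w}=(w_n)_{n=1}^\infty$ in $c_0\setminus\ell_1$ of positive reals with $1=w_1\ge w_2\ge\cdots\ge w_n\ge w_{n+1}\ge\cdots>0$. $\mathcal{O}$ is the set of (strictly) increasing functions from $\mathbb{N}$ to $\mathbb{N}$. For $f=(a_n)_{n=1}^\infty\in\mathbb{F}^{\mathbb{N}}$ put $\|f\|_{g}=\sup_{\phi\in\mathcal{O}}\left(\sum_{n=1}^\infty|a_{\phi(n)}|^pw_n\right)^{1/p}$; the Garling sequence space is the Banach space $g(\mathbf{w},p)=\{f\in\mathbb{F}^{\mathbb{N}}:\|f\|_g<\infty\}$ with this norm. $X\approx Y$ means that the Banach spaces $X,Y$ are isomorphic. A closed subspace $Z$ of $X$ is $C$-complemented if it is the range of a bounded linear projection on $X$ of norm at most $C$. $X$ is complementably homogeneous if for every closed subspace $Y$ of $X$ with $Y\approx X$ there exists a closed subspace $Z\subseteq Y$ such that $Z\approx X$ and $Z$ is complemented in $X$. $X$ is uniformly complementably $Y$-saturated if there is a constant $C$ such that every infinite-dimensional closed subspace of $X$ contains a further subspace $Z\approx Y$ that is $C$-complemented in $X$. *)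

theory Defs
  imports "HOL-Analysis.Analysis" "HOL-Library.Function_Algebras"
begin

text \<open>
  Sequences are indexed from 0, so the \<open>n\<close>-th entry of a sequence \<open>(a\<^sub>n)\<close> with \<open>n \<ge> 1\<close> is \<open>a (n - 1)\<close>.
  The scalar field is a type; all notions below are relative to it (over the complex numbers, linear
  means complex-linear and subspaces and dimensions are complex).
\<close>

definition seq_scale :: "'a::real_normed_field \<Rightarrow> (nat \<Rightarrow> 'a) \<Rightarrow> nat \<Rightarrow> 'a"
  where "seq_scale c f = (\<lambda>n. c * f n)"

global_interpretation seq: vector_space "seq_scale :: 'a::real_normed_field \<Rightarrow> _"
  by unfold_locales (auto simp: seq_scale_def fun_eq_iff algebra_simps)

text \<open>The values of \<open>nrm\<close> outside \<open>carrier\<close> carry no meaning and are never used below.\<close>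

record 'a seq_space =
  carrier :: "(nat \<Rightarrow> 'a) set"
  nrm :: "(nat \<Rightarrow> 'a) \<Rightarrow> real"

definition norm_topology :: "'a::real_normed_field seq_space \<Rightarrow> (nat \<Rightarrow> 'a) topology"
  where "norm_topology X = Metric_space.mtopology (carrier X) (\<lambda>f g. nrm X (f - g))"

definition closed_subspace :: "'a::real_normed_field seq_space \<Rightarrow> (nat \<Rightarrow> 'a) set \<Rightarrow> bool"
  where "closed_subspace X Y \<longleftrightarrow> seq.subspace Y \<and> closedin (norm_topology X) Y"

definition subspace_as_space :: "'a seq_space \<Rightarrow> (nat \<Rightarrow> 'a) set \<Rightarrow> 'a seq_space"
  where "subspace_as_space X Y = X\<lparr>carrier := Y\<rparr>"

definition infinite_dimensional :: "(nat \<Rightarrow> 'a::real_normed_field) set \<Rightarrow> bool"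
  where "infinite_dimensional Y \<longleftrightarrow> \<not> (\<exists>B. finite B \<and> Y \<subseteq> seq.span B)"

definition linear_map ::
    "'a::real_normed_field seq_space \<Rightarrow> 'a seq_space \<Rightarrow> ((nat \<Rightarrow> 'a) \<Rightarrow> nat \<Rightarrow> 'a) \<Rightarrow> bool"
  where "linear_map X Y T \<longleftrightarrow>
    T \<in> carrier X \<rightarrow> carrier Y \<and>
    (\<forall>f\<in>carrier X. \<forall>g\<in>carrier X. T (f + g) = T f + T g) \<and>
    (\<forall>c. \<forall>f\<in>carrier X. T (seq_scale c f) = seq_scale c (T f))"

definition bounded_linear_map ::
    "'a::real_normed_field seq_space \<Rightarrow> 'a seq_space \<Rightarrow> ((nat \<Rightarrow> 'a) \<Rightarrow> nat \<Rightarrow> 'a) \<Rightarrow> bool"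
  where "bounded_linear_map X Y T \<longleftrightarrow>
    linear_map X Y T \<and> (\<exists>C. \<forall>f\<in>carrier X. nrm Y (T f) \<le> C * nrm X f)"

definition isomorphic_spaces ::
    "'a::real_normed_field seq_space \<Rightarrow> 'a seq_space \<Rightarrow> bool"  (infix "\<approx>" 50)
  where "X \<approx> Y \<longleftrightarrow>
    (\<exists>T S. bounded_linear_map X Y T \<and> bounded_linear_map Y X S \<and>
       (\<forall>f\<in>carrier X. S (T f) = f) \<and> (\<forall>g\<in>carrier Y. T (S g) = g))"

definition C_complemented :: "real \<Rightarrow> 'a::real_normed_field seq_space \<Rightarrow> (nat \<Rightarrow> 'a) set \<Rightarrow> bool"
  where "C_complemented C X Z \<longleftrightarrow>
    closed_subspace X Z \<and>
    (\<exists>P. linear_map X X P \<and> (\<forall>f\<in>carrier X. P (P f) = P f) \<and> P ` carrier X = Z \<and>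
       (\<forall>f\<in>carrier X. nrm X (P f) \<le> C * nrm X f))"

definition complemented :: "'a::real_normed_field seq_space \<Rightarrow> (nat \<Rightarrow> 'a) set \<Rightarrow> bool"
  where "complemented X Z \<longleftrightarrow> (\<exists>C. C_complemented C X Z)"

definition complementably_homogeneous :: "'a::real_normed_field seq_space \<Rightarrow> bool"
  where "complementably_homogeneous X \<longleftrightarrow>
    (\<forall>Y. closed_subspace X Y \<and> subspace_as_space X Y \<approx> X \<longrightarrow>
      (\<exists>Z. closed_subspace X Z \<and> Z \<subseteq> Y \<and> subspace_as_space X Z \<approx> X \<and> complemented X Z))"

definition uniformly_complementably_saturated ::
    "'a::real_normed_field seq_space \<Rightarrow> 'a seq_space \<Rightarrow> bool"
  where "uniformly_complementably_saturated X Y \<longleftrightarrow>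
    (\<exists>C. \<forall>V. closed_subspace X V \<and> infinite_dimensional V \<longrightarrow>
      (\<exists>Z. closed_subspace X Z \<and> Z \<subseteq> V \<and> subspace_as_space X Z \<approx> Y \<and> C_complemented C X Z))"

definition lp_space :: "real \<Rightarrow> 'a::real_normed_field seq_space"
  where "lp_space p =
    \<lparr>carrier = {f. summable (\<lambda>n. norm (f n) powr p)},
     nrm = (\<lambda>f. (\<Sum>n. norm (f n) powr p) powr (1 / p))\<rparr>"

definition weights :: "(nat \<Rightarrow> real) set"
  where "weights = {w. w \<longlonglongrightarrow> 0 \<and> \<not> summable (\<lambda>n. \<bar>w n\<bar>) \<and>
    w 0 = 1 \<and> decseq w \<and> (\<forall>n. 0 < w n)}"

text \<open>Only exponents \<open>r > 0\<close> are relevant, so \<open>\<infinity>\<close> is sent to \<open>\<infinity>\<close>.\<close>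

definition ennreal_powr :: "ennreal \<Rightarrow> real \<Rightarrow> ennreal"
  where "ennreal_powr x r = (if x = \<infinity> then \<infinity> else ennreal (enn2real x powr r))"

definition garling_enorm ::
    "(nat \<Rightarrow> real) \<Rightarrow> real \<Rightarrow> (nat \<Rightarrow> 'a::real_normed_field) \<Rightarrow> ennreal"
  where "garling_enorm w p f =
    (SUP \<phi>\<in>{\<phi> :: nat \<Rightarrow> nat. strict_mono \<phi>}.
       ennreal_powr (\<Sum>n. ennreal (norm (f (\<phi> n)) powr p * w n)) (1 / p))"

definition garling_space :: "(nat \<Rightarrow> real) \<Rightarrow> real \<Rightarrow> 'a::real_normed_field seq_space"
  where "garling_space w p =
    \<lparr>carrier = {f. garling_enorm w p f < \<infinity>},
     nrm = (\<lambda>f. enn2real (garling_enorm w p f))\<rparr>"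

end

theory Submission imports Defs begin

text \<open>
  The argument rests on an asymptotic feature of the Garling norm: it is the supremum over finite sets
  \<open>A\<close> of weighted \<open>\<ell>\<^sub>p\<close>-norms, in which the \<open>k\<close>-th element of \<open>A\<close> carries the weight \<open>w k\<close>. Moving a
  finite set \<open>N\<close> positions to the right costs at most \<open>N\<close> times the largest \<open>p\<close>-th power of an entry,
  because the losses \<open>w j - w (N + j)\<close> telescope (\<open>shift_loss\<close>). Vectors with small entries that live
  far to the right are therefore normed on finite sets that can be concatenated, and their sums
  behave like sums in \<open>\<ell>\<^sub>p\<close>. The first consequence is that the tails of every vector tend to zero
  (\<open>tail_from_tendsto\<close>).

  A sequence of unit vectors that are successive up to small tails and have small entries
  (\<open>block_system\<close>) always satisfies an upper \<open>\<ell>\<^sub>p\<close>-estimate, which gives a bounded synthesis operator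
  \<open>synth\<close> from \<open>\<ell>\<^sub>p\<close>. Averaging over the norming sets gives functionals \<open>q\<close>; by Jensen's inequality
  their values at \<open>f\<close> have \<open>p\<close>-th powers that add up to at most a constant times the \<open>p\<close>-th power of the
  norm of \<open>f\<close>, since all averages together are controlled by one weighted sum over the union of the
  norming sets. The matrix of the values of these functionals at the vectors is triangular, and
  forward substitution turns them into a bounded left inverse \<open>coef\<close> of \<open>synth\<close>. The range of \<open>synth\<close>
  is then a complemented copy of \<open>\<ell>\<^sub>p\<close>, with a constant that does not depend on the vectors.

  For saturation it remains to find such vectors in every closed infinite-dimensional subspace
  (\<open>flat_unit_vectors\<close>).

  For complementable homogeneity, let \<open>U\<close> be an isomorphism of the space onto a subspace and
  \<open>u m\<close> the image of the \<open>m\<close>-th unit vector. The coordinates of \<open>u m\<close> tend to zero (\<open>u_coord_null\<close>),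
  but the supremum norms do not (\<open>u_not_flat\<close>): otherwise a subsequence would satisfy a lower
  \<open>\<ell>\<^sub>p\<close>-estimate, whereas the \<open>p\<close>-th power of the norm of a sum of \<open>N\<close> unit vectors is \<open>\<Sum>j<N. w j\<close>, which
  is small compared with \<open>N\<close>. So there are \<open>m k\<close> and \<open>t k\<close>, both increasing, such that the matrix
  with entries \<open>u (m j) (t k)\<close> is almost diagonal. The space is isometric to the closed span of the unit
  vectors indexed by the \<open>m k\<close>; on it, evaluating \<open>U\<close> at the points \<open>t k\<close> and rescaling is a small
  perturbation of the identity, which a Neumann series inverts. Hence the image under \<open>U\<close> of that
  closed span is complemented.
\<close>

section \<open>Weighted power sums\<close>

lemma powr_convex_nonneg:
  assumes "p \<ge> (1::real)"
  shows "convex_on {0..} (\<lambda>x. x powr p)"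
proof (rule convex_onI)
  fix t x y :: real
  assume t: "0 < t" "t < 1" and xy: "x \<in> {0..}" "y \<in> {0..}"
  have shrink: "s powr p \<le> s" if "0 < s" "s < 1" for s :: real
    using that assms powr_mono'[of 1 p s] by simp
  consider "x = 0" | "y = 0" | "x > 0" "y > 0" using xy by fastforce
  then show "((1 - t) *\<^sub>R x + t *\<^sub>R y) powr p \<le> (1 - t) * x powr p + t * y powr p"
  proof cases
    case 1
    have "t powr p * y powr p \<le> t * y powr p"
      using shrink[OF t] by (intro mult_right_mono) auto
    then show ?thesis using 1 t xy assms by (simp add: powr_mult)
  next
    case 2
    have "(1 - t) powr p * x powr p \<le> (1 - t) * x powr p"
      using shrink[of "1 - t"] t by (intro mult_right_mono) auto
    then show ?thesis using 2 t xy assms by (simp add: powr_mult)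
  next
    case 3
    then show ?thesis using convex_onD[OF powr_convex[OF assms], of t x y] t by simp
  qed
qed (rule convex_real_interval)

lemma powr_powr_inverse: "0 \<le> x \<Longrightarrow> p \<ge> 1 \<Longrightarrow> (x powr (1 / p)) powr p = (x::real)"
  by (simp add: powr_powr)

lemma powr_inverse_powr: "0 \<le> x \<Longrightarrow> p \<ge> 1 \<Longrightarrow> (x powr p) powr (1 / p) = (x::real)"
  by (simp add: powr_powr)

lemma powr_le_one_over: "x \<ge> 1 \<Longrightarrow> p \<ge> 1 \<Longrightarrow> x powr (1 / p) \<le> (x::real)"
  using powr_mono[of "1 / p" 1 x] by simp

lemma sum_fun_apply: "(\<Sum>k\<in>I. g k) i = (\<Sum>k\<in>I. g k i)"
  for g :: "'b \<Rightarrow> nat \<Rightarrow> 'a::comm_monoid_add"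
  by (induction I rule: infinite_finite_induct) auto

text \<open>The \<open>\<ell>\<^sub>p\<close>-norm of \<open>f\<close> on \<open>A\<close> with respect to the weight \<open>u\<close>.\<close>

definition wlp :: "real \<Rightarrow> nat set \<Rightarrow> (nat \<Rightarrow> real) \<Rightarrow> (nat \<Rightarrow> 'a::real_normed_field) \<Rightarrow> real"
  where "wlp p A u f = (\<Sum>a\<in>A. norm (f a) powr p * u a) powr (1 / p)"

lemma wlp_nonneg: "wlp p A u f \<ge> 0"
  by (simp add: wlp_def)

lemma wlp_le_iff:
  assumes "p \<ge> 1" "\<And>a. u a \<ge> 0" "M \<ge> 0"
  shows "wlp p A u f \<le> M \<longleftrightarrow> (\<Sum>a\<in>A. norm (f a) powr p * u a) \<le> M powr p"
proof -
  have s: "(\<Sum>a\<in>A. norm (f a) powr p * u a) \<ge> 0" using assms by (intro sum_nonneg) auto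
  show ?thesis
  proof
    assume "wlp p A u f \<le> M"
    then have "(wlp p A u f) powr p \<le> M powr p"
      using assms by (intro powr_mono2) (auto simp: wlp_nonneg)
    then show "(\<Sum>a\<in>A. norm (f a) powr p * u a) \<le> M powr p"
      using powr_powr_inverse[OF s assms(1)] by (simp add: wlp_def)
  next
    assume "(\<Sum>a\<in>A. norm (f a) powr p * u a) \<le> M powr p"
    then have "wlp p A u f \<le> (M powr p) powr (1/p)"
      unfolding wlp_def using assms s by (intro powr_mono2) auto
    then show "wlp p A u f \<le> M" using powr_inverse_powr assms by simp
  qed
qed

lemma wlp_powr:
  assumes "p \<ge> 1" "\<And>a. u a \<ge> 0"
  shows "wlp p A u f powr p = (\<Sum>a\<in>A. norm (f a) powr p * u a)"
  unfolding wlp_def using assms by (intro powr_powr_inverse sum_nonneg) auto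

lemma wlp_mono:
  assumes "p \<ge> 1" "\<And>a. u a \<ge> 0" "\<And>a. a \<in> A \<Longrightarrow> norm (f a) \<le> norm (g a)"
  shows "wlp p A u f \<le> wlp p A u g"
  unfolding wlp_def using assms
  by (intro powr_mono2 sum_mono mult_right_mono sum_nonneg) auto

lemma wlp_scale:
  assumes "p \<ge> 1" "\<And>a. u a \<ge> 0"
  shows "wlp p A u (seq_scale c f) = norm c * wlp p A u f"
proof -
  have "(\<Sum>a\<in>A. norm (c * f a) powr p * u a) = norm c powr p * (\<Sum>a\<in>A. norm (f a) powr p * u a)"
    by (simp add: sum_distrib_left norm_mult powr_mult mult_ac)
  then show ?thesis
    using assms by (simp add: wlp_def seq_scale_def powr_mult powr_inverse_powr sum_nonneg)
qed

text \<open>Minkowski's inequality: for \<open>s\<close> and \<open>t\<close> above the two norms, \<open>f + g\<close> is \<open>s + t\<close> times a convex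
  combination of \<open>f / s\<close> and \<open>g / t\<close>.\<close>

lemma wlp_triangle:
  assumes "p \<ge> 1" "\<And>a. u a \<ge> 0"
  shows "wlp p A u (f + g) \<le> wlp p A u f + wlp p A u g"
proof -
  let ?s = "wlp p A u f" and ?t = "wlp p A u g"
  have main: "wlp p A u (f + g) \<le> s + t" if st: "s > 0" "t > 0" "?s \<le> s" "?t \<le> t" for s t
  proof -
    have "norm ((f + g) a) powr p * u a
        \<le> (s + t) powr p * (s / (s + t) * (norm (f a) powr p * u a / s powr p)
             + t / (s + t) * (norm (g a) powr p * u a / t powr p))" for a
    proof -
      let ?x = "norm (f a) / s" and ?y = "norm (g a) / t"
      have "norm ((f + g) a) \<le> norm (f a) + norm (g a)" by (simp add: norm_triangle_ineq)
      also have "\<dots> = (s + t) * ((1 - t / (s + t)) * ?x + t / (s + t) * ?y)"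
      proof -
        have "(s + t) * (1 - t / (s + t)) = s" "(s + t) * (t / (s + t)) = t"
          using st by (simp_all add: field_simps)
        then have "(s + t) * ((1 - t / (s + t)) * ?x + t / (s + t) * ?y) = s * ?x + t * ?y"
          by (metis (no_types, lifting) distrib_left mult.assoc)
        then show ?thesis using st by simp
      qed
      finally have "norm ((f + g) a) powr p
          \<le> ((s + t) * ((1 - t / (s + t)) * ?x + t / (s + t) * ?y)) powr p"
        using assms by (intro powr_mono2) auto
      also have "\<dots> = (s + t) powr p * ((1 - t / (s + t)) * ?x + t / (s + t) * ?y) powr p"
        using st by (subst powr_mult) auto
      also have "\<dots> \<le> (s + t) powr p * ((1 - t / (s + t)) * ?x powr p + t / (s + t) * ?y powr p)"
        using convex_onD[OF powr_convex_nonneg[OF assms(1)], of "t / (s + t)" ?x ?y] st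
        by (intro mult_left_mono) auto
      also have "\<dots> = (s + t) powr p * (s / (s + t) * (norm (f a) powr p / s powr p)
             + t / (s + t) * (norm (g a) powr p / t powr p))"
      proof -
        have "1 - t / (s + t) = s / (s + t)" using st by (simp add: field_simps)
        then show ?thesis using st by (simp add: powr_divide)
      qed
      finally show ?thesis
        using mult_right_mono[OF _ assms(2)[of a]] by (fastforce simp: algebra_simps)
    qed
    then have "(\<Sum>a\<in>A. norm ((f + g) a) powr p * u a)
       \<le> (\<Sum>a\<in>A. (s + t) powr p * (s / (s + t) * (norm (f a) powr p * u a / s powr p)
             + t / (s + t) * (norm (g a) powr p * u a / t powr p)))"
      by (intro sum_mono) auto
    also have "\<dots> = (s + t) powr p *
        (s / (s + t) * ((\<Sum>a\<in>A. norm (f a) powr p * u a) / s powr p)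
          + t / (s + t) * ((\<Sum>a\<in>A. norm (g a) powr p * u a) / t powr p))"
      by (simp add: sum_distrib_left sum.distrib sum_divide_distrib distrib_left)
    also have "\<dots> \<le> (s + t) powr p * (s / (s + t) * 1 + t / (s + t) * 1)"
    proof -
      have "(\<Sum>a\<in>A. norm (f a) powr p * u a) \<le> s powr p" "(\<Sum>a\<in>A. norm (g a) powr p * u a) \<le> t powr p"
        using st wlp_le_iff[of p u s A f] wlp_le_iff[of p u t A g] assms by simp_all
      then show ?thesis using st by (intro mult_left_mono add_mono) auto
    qed
    also have "\<dots> = (s + t) powr p" using st by (simp add: add_divide_distrib[symmetric])
    finally show ?thesis using wlp_le_iff[of p u "s + t" A "f + g"] st assms by simp
  qed
  show ?thesis
  proof (rule field_le_epsilon)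
    fix e :: real assume "0 < e"
    then show "wlp p A u (f + g) \<le> ?s + ?t + e"
      using main[of "?s + e/2" "?t + e/2"] wlp_nonneg[of p A u f] wlp_nonneg[of p A u g] by simp
  qed
qed

lemma wlp_sum:
  assumes "p \<ge> 1" "\<And>a. u a \<ge> 0"
  shows "wlp p A u (\<Sum>k\<in>I. g k) \<le> (\<Sum>k\<in>I. wlp p A u (g k))"
proof (induction I rule: infinite_finite_induct)
  case (insert x F)
  then show ?case using wlp_triangle[of p u A "g x" "sum g F"] assms by (auto simp del: plus_fun_apply simp: plus_fun_def intro: order_trans)
qed (simp_all add: wlp_def)

text \<open>A weighted \<open>\<ell>\<^sub>p\<close>-norm with weights at most one is dominated by the \<open>\<ell>\<^sub>1\<close>-norm.\<close>

lemma wlp_le_sum: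
  assumes "p \<ge> 1" "\<And>a. u a \<ge> 0" "\<And>a. u a \<le> 1" "finite A"
  shows "wlp p A u f \<le> (\<Sum>a\<in>A. norm (f a))"
proof -
  define g where "g k = (\<lambda>a. if a = k then f a else 0)" for k
  have "wlp p A u (g k) \<le> norm (f k)" if "k \<in> A" for k
  proof -
    have "(\<Sum>a\<in>A. norm (g k a) powr p * u a) = norm (f k) powr p * u k"
      using that assms(4) by (simp add: g_def if_distrib[of norm] if_distrib[of "\<lambda>x. x powr p"]
          if_distrib[of "\<lambda>x. x * _"] sum.delta cong: if_cong)
    also have "\<dots> \<le> norm (f k) powr p" using assms by (simp add: mult_left_le)
    finally show ?thesis using wlp_le_iff[of p u "norm (f k)" A "g k"] assms by simp
  qed
  then have "(\<Sum>k\<in>A. wlp p A u (g k)) \<le> (\<Sum>a\<in>A. norm (f a))" by (intro sum_mono)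
  moreover have "wlp p A u (\<Sum>k\<in>A. g k) = wlp p A u f"
    unfolding wlp_def
    by (intro arg_cong2[of _ _ _ _ "(powr)"] sum.cong)
       (use assms(4) in \<open>auto simp: sum_fun_apply g_def\<close>)
  ultimately show ?thesis using wlp_sum[of p u A g A, OF assms(1,2)] by linarith
qed

text \<open>The position of \<open>a\<close>, counted from zero, in the increasing enumeration of \<open>A\<close>.\<close>

definition rk :: "nat set \<Rightarrow> nat \<Rightarrow> nat"
  where "rk A a = card {b\<in>A. b < a}"

lemma rk_mono_set: "B \<subseteq> A \<Longrightarrow> rk B a \<le> rk A a"
  unfolding rk_def by (intro card_mono) auto

lemma rk_strict_mono: "finite A \<Longrightarrow> a \<in> A \<Longrightarrow> a < b \<Longrightarrow> rk A a < rk A b"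
  unfolding rk_def by (intro psubset_card_mono) auto

lemma bij_betw_rk: assumes "finite A" shows "bij_betw (rk A) A {..<card A}"
proof -
  have inj: "inj_on (rk A) A"
    by (intro inj_onI) (metis assms linorder_neqE_nat nat_neq_iff rk_strict_mono)
  moreover have "rk A ` A \<subseteq> {..<card A}"
    unfolding rk_def using assms by (auto intro!: psubset_card_mono)
  ultimately have "rk A ` A = {..<card A}"
    by (intro card_subset_eq) (auto simp: card_image)
  then show ?thesis using inj by (simp add: bij_betw_def)
qed

lemma sum_rk: "finite A \<Longrightarrow> (\<Sum>a\<in>A. h (rk A a)) = (\<Sum>j<card A. h j)"
  using sum.reindex_bij_betw[OF bij_betw_rk] by blast

lemma rk_image:
  assumes "strict_mono t"
  shows "rk (t ` A) (t a) = rk A a"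
proof -
  have "{b \<in> t ` A. b < t a} = t ` {b\<in>A. b < a}"
    using assms by (auto simp: strict_mono_less)
  moreover have "inj_on t {b\<in>A. b < a}" using assms by (intro inj_onI) (simp add: strict_mono_eq)
  ultimately show ?thesis unfolding rk_def by (simp add: card_image)
qed

lemma rk_range:
  assumes "strict_mono t"
  shows "rk (t -` A) k \<le> rk A (t k)"
proof -
  have "rk (t -` A) k = rk (t ` (t -` A)) (t k)" by (rule rk_image[OF assms, symmetric])
  also have "\<dots> \<le> rk A (t k)" by (rule rk_mono_set) auto
  finally show ?thesis .
qed

lemma rk_append:
  assumes "finite A" "A \<subseteq> {..<n}" "B \<subseteq> {n..}" "b \<in> B"
  shows "rk (A \<union> B) b = card A + rk B b"
proof -
  have "{x \<in> A \<union> B. x < b} = A \<union> {x\<in>B. x < b}" using assms by fastforce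
  moreover have "A \<inter> {x\<in>B. x < b} = {}" using assms by fastforce
  ultimately show ?thesis unfolding rk_def using assms by (simp add: card_Un_disjoint)
qed

lemma rk_append_left:
  assumes "A \<subseteq> {..<n}" "B \<subseteq> {n..}" "a \<in> A"
  shows "rk (A \<union> B) a = rk A a"
proof -
  have "{x \<in> A \<union> B. x < a} = {x\<in>A. x < a}" using assms by fastforce
  then show ?thesis unfolding rk_def by simp
qed

section \<open>The Garling norm as a supremum over finite sets\<close>

locale garling =
  fixes w :: "nat \<Rightarrow> real" and p :: real
  assumes w: "w \<in> weights" and p: "1 \<le> p"
begin

lemma w_nonneg: "0 \<le> w n" and w_antimono: "m \<le> n \<Longrightarrow> w n \<le> w m"
  and w_lim: "w \<longlonglongrightarrow> 0" and w_not_summable: "\<not> summable w" and w_zero: "w 0 = 1"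
proof -
  have pos: "0 < w n" for n using w by (auto simp: weights_def)
  show "0 \<le> w n" using pos[of n] by simp
  show "m \<le> n \<Longrightarrow> w n \<le> w m" using w by (auto simp: weights_def decseq_def)
  show "w \<longlonglongrightarrow> 0" "w 0 = 1" using w by (auto simp: weights_def)
  have "(\<lambda>n. \<bar>w n\<bar>) = w" using pos by (auto simp: fun_eq_iff abs_of_pos)
  then show "\<not> summable w" using w by (auto simp: weights_def)
qed

lemma w_le_1: "w n \<le> 1"
  using w_antimono[of 0 n] w_zero by simp

abbreviation (input) garling_sp :: "'a::{real_normed_field,banach} seq_space"
  where "garling_sp \<equiv> garling_space w p"

abbreviation X :: "(nat \<Rightarrow> 'a::{real_normed_field,banach}) set"
  where "X \<equiv> carrier (garling_space w p)"

abbreviation gn :: "(nat \<Rightarrow> 'a::{real_normed_field,banach}) \<Rightarrow> real"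
  where "gn \<equiv> nrm (garling_space w p)"

text \<open>The weighted norm of \<open>f\<close> along the increasing enumeration of the finite set \<open>A\<close>. The
  supremum of these seminorms over all finite \<open>A\<close> is the Garling norm, which is what \<open>garlingI\<close> and
  \<open>sn_le_gn\<close> express.\<close>

definition sn :: "nat set \<Rightarrow> (nat \<Rightarrow> 'a::{real_normed_field,banach}) \<Rightarrow> real"
  where "sn A f = wlp p A (\<lambda>a. w (rk A a)) f"

lemma garlingI:
  assumes "M \<ge> 0" and "\<And>A. finite A \<Longrightarrow> sn A f \<le> M"
  shows "f \<in> X" and "gn f \<le> M"
proof -
  have *: "ennreal_powr (\<Sum>n. ennreal (norm (f (\<phi> n)) powr p * w n)) (1 / p) \<le> ennreal M"
    if \<phi>: "strict_mono \<phi>" for \<phi>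
  proof -
    have part: "(\<Sum>n<N. norm (f (\<phi> n)) powr p * w n) \<le> M powr p" for N
    proof -
      have "rk {..<N} n = n" if "n < N" for n
      proof -
        have "{b \<in> {..<N}. b < n} = {..<n}" using that by auto
        then show ?thesis by (simp add: rk_def)
      qed
      then have rk: "rk (\<phi> ` {..<N}) (\<phi> n) = n" if "n < N" for n
        using rk_image[OF \<phi>, of "{..<N}" n] that by simp
      have "(\<Sum>n<N. norm (f (\<phi> n)) powr p * w n)
          = (\<Sum>n<N. norm (f (\<phi> n)) powr p * w (rk (\<phi> ` {..<N}) (\<phi> n)))"
        by (intro sum.cong) (auto simp: rk)
      also have "\<dots> = (\<Sum>a\<in>\<phi> ` {..<N}. norm (f a) powr p * w (rk (\<phi> ` {..<N}) a))"
        using \<phi> by (subst sum.reindex) (auto intro: strict_mono_imp_inj_on inj_on_subset)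
      also have "\<dots> \<le> M powr p"
      proof -
        have "wlp p (\<phi> ` {..<N}) (\<lambda>a. w (rk (\<phi> ` {..<N}) a)) f \<le> M"
          using assms(2)[of "\<phi> ` {..<N}"] by (simp add: sn_def)
        then show ?thesis using assms(1) by (subst (asm) wlp_le_iff) (auto simp: p w_nonneg)
      qed
      finally show ?thesis .
    qed
    let ?S = "\<Sum>n. ennreal (norm (f (\<phi> n)) powr p * w n)"
    have S: "?S \<le> ennreal (M powr p)"
    proof (rule suminf_le_const)
      show "sum (\<lambda>n. ennreal (norm (f (\<phi> n)) powr p * w n)) {..<N} \<le> ennreal (M powr p)" for N
        using part[of N] by (subst sum_ennreal) (auto simp: w_nonneg intro: ennreal_leI)
    qed auto
    have "?S < \<infinity>" using S by (rule le_less_trans) simp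
    moreover have "enn2real ?S \<le> M powr p" using S by (rule enn2real_leI[rotated]) simp
    moreover have "enn2real ?S powr (1/p) \<le> (M powr p) powr (1/p)"
      using calculation p by (intro powr_mono2) auto
    ultimately show ?thesis
      using powr_inverse_powr[OF assms(1) p] by (auto simp: ennreal_powr_def intro: ennreal_leI)
  qed
  then have "garling_enorm w p f \<le> ennreal M"
    unfolding garling_enorm_def by (auto intro: SUP_least)
  then show "f \<in> X" "gn f \<le> M"
    using assms(1) by (auto simp: garling_space_def intro: le_less_trans enn2real_leI)
qed

lemma sn_le_gn:
  assumes "f \<in> X" "finite A"
  shows "sn A f \<le> gn f"
proof -
  obtain n where n: "\<And>a. a \<in> A \<Longrightarrow> a < n"
    using assms(2) finite_nat_set_iff_bounded by auto
  \<comment> \<open>enumerate \<open>A\<close> first and continue arbitrarily\<close>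
  let ?I = "A \<union> {n..}"
  define \<phi> where "\<phi> = enumerate ?I"
  have inf: "infinite ?I" by (simp add: infinite_Ici)
  have \<phi>: "strict_mono \<phi>" unfolding \<phi>_def strict_mono_def using enumerate_mono[OF _ inf] by auto
  have ran: "range \<phi> = ?I" unfolding \<phi>_def using inf by (rule range_enumerate)
  have rk: "\<phi> (rk A a) = a" if "a \<in> A" for a
  proof -
    have "a \<in> range \<phi>" using ran that by simp
    then obtain k where k: "\<phi> k = a" by blast
    have "{b \<in> A. b < a} = \<phi> ` {..<k}"
    proof
      show "{b \<in> A. b < a} \<subseteq> \<phi> ` {..<k}"
      proof
        fix b assume b: "b \<in> {b \<in> A. b < a}"
        then have "b \<in> range \<phi>" using ran by simp
        then obtain j where "\<phi> j = b" by blast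
        moreover from this have "j < k" using b k strict_mono_less[OF \<phi>, of j k] by simp
        ultimately show "b \<in> \<phi> ` {..<k}" by auto
      qed
      show "\<phi> ` {..<k} \<subseteq> {b \<in> A. b < a}"
      proof
        fix b assume "b \<in> \<phi> ` {..<k}"
        then obtain j where "b = \<phi> j" "j < k" by auto
        then have "b < a" "b \<in> ?I" using k \<phi> ran by (auto simp: strict_mono_less)
        then show "b \<in> {b \<in> A. b < a}" using n[OF that] by auto
      qed
    qed
    then have "rk A a = k" unfolding rk_def
      using \<phi> by (simp add: card_image strict_mono_imp_inj_on inj_on_subset)
    then show ?thesis using k by simp
  qed
  let ?S = "\<Sum>n. ennreal (norm (f (\<phi> n)) powr p * w n)"
  have "(\<Sum>a\<in>A. norm (f a) powr p * w (rk A a))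
      = (\<Sum>a\<in>A. norm (f (\<phi> (rk A a))) powr p * w (rk A a))"
    by (intro sum.cong) (auto simp: rk)
  also have "\<dots> = (\<Sum>j<card A. norm (f (\<phi> j)) powr p * w j)" by (rule sum_rk[OF assms(2)])
  finally have "ennreal (\<Sum>a\<in>A. norm (f a) powr p * w (rk A a))
      = (\<Sum>j<card A. ennreal (norm (f (\<phi> j)) powr p * w j))"
    by (subst sum_ennreal) (auto simp: w_nonneg)
  also have "\<dots> \<le> ?S" by (rule sum_le_suminf) auto
  finally have S: "ennreal (\<Sum>a\<in>A. norm (f a) powr p * w (rk A a)) \<le> ?S" .
  have nn: "(\<Sum>a\<in>A. norm (f a) powr p * w (rk A a)) \<ge> 0" by (intro sum_nonneg) (auto simp: w_nonneg)
  have "ennreal (sn A f) \<le> ennreal_powr ?S (1/p)"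
  proof (cases "?S = \<infinity>")
    case False
    then have "(\<Sum>a\<in>A. norm (f a) powr p * w (rk A a)) \<le> enn2real ?S"
      using S enn2real_mono[OF S] nn by (simp add: less_top)
    then show ?thesis
      using False nn p by (auto simp: ennreal_powr_def sn_def wlp_def intro!: ennreal_leI powr_mono2)
  qed (simp add: ennreal_powr_def)
  also have "\<dots> \<le> garling_enorm w p f"
    unfolding garling_enorm_def using \<phi> by (intro SUP_upper) auto
  finally have "ennreal (sn A f) \<le> garling_enorm w p f" .
  moreover have "garling_enorm w p f < \<infinity>" using assms(1) by (simp add: garling_space_def)
  ultimately have "enn2real (ennreal (sn A f)) \<le> enn2real (garling_enorm w p f)"
    by (intro enn2real_mono) auto
  then show ?thesis by (simp add: garling_space_def sn_def wlp_nonneg)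
qed

lemma gn_nonneg [simp]: "gn f \<ge> 0"
  by (simp add: garling_space_def)

lemma gn_leI: "M \<ge> 0 \<Longrightarrow> (\<And>A. finite A \<Longrightarrow> sn A f \<le> M) \<Longrightarrow> f \<in> X \<and> gn f \<le> M"
  by (intro conjI garlingI)

lemma sn_nonneg [simp]: "sn A f \<ge> 0" by (simp add: sn_def wlp_nonneg)

lemma sn_powr: "sn A f powr p = (\<Sum>a\<in>A. norm (f a) powr p * w (rk A a))"
  unfolding sn_def by (rule wlp_powr) (auto simp: p w_nonneg)

lemma sn_le_iff: "M \<ge> 0 \<Longrightarrow> sn A f \<le> M \<longleftrightarrow> (\<Sum>a\<in>A. norm (f a) powr p * w (rk A a)) \<le> M powr p"
  unfolding sn_def by (rule wlp_le_iff) (auto simp: p w_nonneg)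

lemma gn_powr_ge:
  "f \<in> X \<Longrightarrow> finite A \<Longrightarrow> (\<Sum>a\<in>A. norm (f a) powr p * w (rk A a)) \<le> gn f powr p"
  using sn_le_iff[of "gn f" A f] sn_le_gn[of f A] by simp

lemma sn_triangle: "sn A (f + g) \<le> sn A f + sn A g"
  unfolding sn_def by (rule wlp_triangle) (auto simp: p w_nonneg)

lemma sn_sum: "sn A (\<Sum>k\<in>I. g k) \<le> (\<Sum>k\<in>I. sn A (g k))"
  unfolding sn_def by (rule wlp_sum) (auto simp: p w_nonneg)

lemma sn_scale: "sn A (seq_scale c f) = norm c * sn A f"
  unfolding sn_def by (rule wlp_scale) (auto simp: p w_nonneg)

lemma sn_mono: "(\<And>a. a \<in> A \<Longrightarrow> norm (f a) \<le> norm (g a)) \<Longrightarrow> sn A f \<le> sn A g"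
  unfolding sn_def by (rule wlp_mono) (auto simp: p w_nonneg)

lemma sn_cong: "(\<And>a. a \<in> A \<Longrightarrow> f a = g a) \<Longrightarrow> sn A f = sn A g"
  by (intro antisym sn_mono) auto

lemma sn_le_sum: "finite A \<Longrightarrow> sn A f \<le> (\<Sum>a\<in>A. norm (f a))"
  unfolding sn_def by (rule wlp_le_sum) (auto simp: p w_nonneg w_le_1)

lemma X_add: assumes "f \<in> X" "g \<in> X" shows "f + g \<in> X" "gn (f + g) \<le> gn f + gn g"
proof -
  have "sn A (f + g) \<le> gn f + gn g" if "finite A" for A
    using sn_triangle[of A f g] sn_le_gn[OF assms(1) that] sn_le_gn[OF assms(2) that] by linarith
  then show "f + g \<in> X" "gn (f + g) \<le> gn f + gn g"
    using gn_leI[of "gn f + gn g" "f + g"] by auto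
qed

lemma X_scale: assumes "f \<in> X" shows "seq_scale c f \<in> X" "gn (seq_scale c f) \<le> norm c * gn f"
proof -
  have "sn A (seq_scale c f) \<le> norm c * gn f" if "finite A" for A
    using sn_le_gn[OF assms that] by (simp add: sn_scale mult_left_mono)
  then show "seq_scale c f \<in> X" "gn (seq_scale c f) \<le> norm c * gn f"
    using gn_leI[of "norm c * gn f" "seq_scale c f"] by auto
qed

lemma X_mono: assumes "f \<in> X" "\<And>a. norm (g a) \<le> norm (f a)" shows "g \<in> X" "gn g \<le> gn f"
proof -
  have "sn A g \<le> gn f" if "finite A" for A
    using sn_le_gn[OF assms(1) that] sn_mono[of A g f] assms(2) by fastforce
  then show "g \<in> X" "gn g \<le> gn f" using gn_leI[of "gn f" g] by auto
qed

lemma X_0 [simp]: "(0 :: nat \<Rightarrow> 'a::{real_normed_field,banach}) \<in> X" "gn (0 :: nat \<Rightarrow> 'a) = 0"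
proof -
  have "sn A (0 :: nat \<Rightarrow> 'a) \<le> 0" for A by (simp add: sn_def wlp_def)
  then show "(0 :: nat \<Rightarrow> 'a) \<in> X" "gn (0 :: nat \<Rightarrow> 'a) = 0"
    using gn_leI[of 0 "0 :: nat \<Rightarrow> 'a"] gn_nonneg[of "0 :: nat \<Rightarrow> 'a"] by force+
qed

lemma X_diff: assumes "f \<in> X" "g \<in> X" shows "f - g \<in> X" "gn (f - g) \<le> gn f + gn g"
proof -
  have "f - g = f + seq_scale (-1) g" by (auto simp: fun_eq_iff seq_scale_def)
  then show "f - g \<in> X" "gn (f - g) \<le> gn f + gn g"
    using X_add[OF assms(1) X_scale(1)[OF assms(2), of "-1"]] X_scale[OF assms(2), of "-1"] by auto
qed

lemma X_sum: "(\<And>k. k \<in> I \<Longrightarrow> g k \<in> X) \<Longrightarrow> (\<Sum>k\<in>I. g k) \<in> X"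
  by (induction I rule: infinite_finite_induct) (auto intro: X_add simp del: plus_fun_apply)

lemma gn_sum: "(\<And>k. k \<in> I \<Longrightarrow> g k \<in> X) \<Longrightarrow> gn (\<Sum>k\<in>I. g k) \<le> (\<Sum>k\<in>I. gn (g k))"
proof (induction I rule: infinite_finite_induct)
  case (insert x F)
  have "gn (\<Sum>k\<in>insert x F. g k) = gn (g x + sum g F)" using insert.hyps by simp
  also have "\<dots> \<le> gn (g x) + gn (sum g F)" using insert.prems by (intro X_add X_sum) auto
  also have "\<dots> \<le> gn (g x) + (\<Sum>k\<in>F. gn (g k))" using insert by simp
  also have "\<dots> = (\<Sum>k\<in>insert x F. gn (g k))" using insert.hyps by simp
  finally show ?case .
qed auto

lemma coord_le_gn: assumes "f \<in> X" shows "norm (f i) \<le> gn f"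
proof -
  have "rk {i} i = 0" by (simp add: rk_def)
  then have "sn {i} f = norm (f i)"
    using p by (simp add: sn_def wlp_def w_zero powr_inverse_powr)
  then show ?thesis using sn_le_gn[OF assms, of "{i}"] by simp
qed

lemma gn_eq_0: assumes "f \<in> X" "gn f = 0" shows "f = 0"
  using coord_le_gn[OF assms(1)] assms(2) by (auto simp: fun_eq_iff)

lemma gn_diff_commute: "gn (f - g) = gn (g - f)"
proof -
  have "garling_enorm w p (f - g) = garling_enorm w p (g - f)"
    unfolding garling_enorm_def by (simp add: norm_minus_commute)
  then show ?thesis by (simp add: garling_space_def)
qed

sublocale ms: Metric_space "X :: (nat \<Rightarrow> 'a::{real_normed_field,banach}) set" "\<lambda>f g. gn (f - g)"
proof
  show "0 \<le> gn (x - y)" for x y :: "nat \<Rightarrow> 'a" by simp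
  show "gn (x - y) = gn (y - x)" for x y :: "nat \<Rightarrow> 'a" by (rule gn_diff_commute)
  show "gn (x - y) = 0 \<longleftrightarrow> x = y" if "x \<in> X" "y \<in> X" for x y :: "nat \<Rightarrow> 'a"
  proof
    assume "gn (x - y) = 0"
    then have "x - y = 0" using gn_eq_0 X_diff(1)[OF that] by blast
    then show "x = y" by simp
  qed simp
  show "gn (x - z) \<le> gn (x - y) + gn (y - z)" if "x \<in> X" "y \<in> X" "z \<in> X" for x y z :: "nat \<Rightarrow> 'a"
    using X_add(2)[OF X_diff(1)[OF that(1,2)] X_diff(1)[OF that(2,3)]] by simp
qed

lemma closed_subspace_iff:
  "closed_subspace garling_sp Y \<longleftrightarrow> seq.subspace Y \<and> Y \<subseteq> X \<and>
     (\<forall>f\<in>X. (\<forall>e>0. \<exists>g\<in>Y. gn (f - g) < e) \<longrightarrow> f \<in> Y)"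
  unfolding closed_subspace_def norm_topology_def ms.closedin_metric
  by (auto simp: disjnt_iff ms.in_mball subset_iff) (meson linorder_not_less)+

end

section \<open>Bounded operators and complemented ranges\<close>

context garling begin

lemma bounded_linear_mapD:
  assumes "bounded_linear_map V W T"
  obtains C where "C \<ge> 0" "\<And>f. f \<in> carrier V \<Longrightarrow> nrm V f \<ge> 0 \<Longrightarrow> nrm W (T f) \<le> C * nrm V f"
proof -
  obtain C where C: "\<forall>f\<in>carrier V. nrm W (T f) \<le> C * nrm V f"
    using assms by (auto simp: bounded_linear_map_def)
  show thesis
  proof (rule that[of "max C 0"])
    fix f assume f: "f \<in> carrier V" "nrm V f \<ge> 0"
    have "nrm W (T f) \<le> C * nrm V f" using C f by blast
    also have "\<dots> \<le> max C 0 * nrm V f" using f by (intro mult_right_mono) auto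
    finally show "nrm W (T f) \<le> max C 0 * nrm V f" .
  qed simp
qed

text \<open>A bounded operator \<open>S\<close> into the Garling space with a bounded left inverse \<open>Q\<close> is an
  isomorphism onto its range, and \<open>S \<circ> Q\<close> is a projection onto that range.\<close>

lemma range_complemented:
  fixes S Q :: "(nat \<Rightarrow> 'a::{real_normed_field,banach}) \<Rightarrow> nat \<Rightarrow> 'a"
  assumes S: "linear_map W garling_sp S" and Q: "linear_map garling_sp W Q"
    and CS: "\<And>b. b \<in> carrier W \<Longrightarrow> gn (S b) \<le> C * nrm W b" and C: "C \<ge> 0"
    and DQ: "\<And>f. f \<in> X \<Longrightarrow> nrm W (Q f) \<le> D * gn f"
    and QS: "\<And>b. b \<in> carrier W \<Longrightarrow> Q (S b) = b"
  shows "C_complemented (C * D) garling_sp (S ` carrier W)"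
    and "subspace_as_space garling_sp (S ` carrier W) \<approx> W"
proof -
  let ?Z = "S ` carrier W"
  have SX: "S b \<in> X" if "b \<in> carrier W" for b using S that by (auto simp: linear_map_def)
  have QW: "Q f \<in> carrier W" if "f \<in> X" for f using Q that by (auto simp: linear_map_def)
  have Z: "?Z = {f \<in> X. S (Q f) = f}" using SX QW QS by force
  have Qadd: "Q (f + g) = Q f + Q g" if "f \<in> X" "g \<in> X" for f g
    using Q that unfolding linear_map_def by blast
  have Sadd: "S (f + g) = S f + S g" if "f \<in> carrier W" "g \<in> carrier W" for f g
    using S that unfolding linear_map_def by blast
  have Qsc: "Q (seq_scale c f) = seq_scale c (Q f)" if "f \<in> X" for c f
    using Q that unfolding linear_map_def by blast
  have Ssc: "S (seq_scale c f) = seq_scale c (S f)" if "f \<in> carrier W" for c f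
    using S that unfolding linear_map_def by blast
  let ?P = "\<lambda>f. S (Q f)"
  have Padd: "?P (f + g) = ?P f + ?P g" if "f \<in> X" "g \<in> X" for f g
    using that by (simp only: Qadd Sadd QW)
  have Psc: "?P (seq_scale c f) = seq_scale c (?P f)" if "f \<in> X" for c f
    using that by (simp only: Qsc Ssc QW)
  have Plin: "linear_map garling_sp garling_sp ?P"
    unfolding linear_map_def using QW SX Padd Psc by auto
  have Pbd: "gn (?P f) \<le> C * D * gn f" if "f \<in> X" for f
  proof -
    have "gn (?P f) \<le> C * nrm W (Q f)" using CS QW that by blast
    also have "\<dots> \<le> C * (D * gn f)" using DQ[OF that] C by (rule mult_left_mono)
    finally show ?thesis by simp
  qed
  have zero: "?P 0 = 0" using Psc[OF X_0(1), of 0] by (simp add: seq_scale_def zero_fun_def)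
  have sub: "seq.subspace ?Z"
    unfolding seq.subspace_def
  proof (intro conjI ballI allI)
    show "0 \<in> ?Z" using zero unfolding Z by simp
    show "x + y \<in> ?Z" if "x \<in> ?Z" "y \<in> ?Z" for x y
    proof -
      from that have *: "x \<in> X" "y \<in> X" "?P x = x" "?P y = y" unfolding Z by auto
      have "?P (x + y) = x + y" using Padd[OF *(1,2)] *(3,4) by simp
      then show ?thesis unfolding Z using X_add(1)[OF *(1,2)] by simp
    qed
    show "seq_scale c x \<in> ?Z" if "x \<in> ?Z" for c x
    proof -
      from that have *: "x \<in> X" "?P x = x" unfolding Z by auto
      have "?P (seq_scale c x) = seq_scale c x" using Psc[OF *(1)] *(2) by simp
      then show ?thesis unfolding Z using X_scale(1)[OF *(1)] by simp
    qed
  qed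
  have cl: "closed_subspace garling_sp ?Z"
    unfolding closed_subspace_iff
  proof (intro conjI ballI impI sub)
    show "?Z \<subseteq> X" using SX by auto
    fix f :: "nat \<Rightarrow> 'a" assume f: "f \<in> X" and app: "\<forall>e>0. \<exists>g\<in>?Z. gn (f - g) < e"
    have bound: "gn (?P f - f) \<le> (\<bar>C * D\<bar> + 1) * e" if "e > 0" for e
    proof -
      from app[rule_format, OF that] obtain g where g: "g \<in> ?Z" "gn (f - g) < e" by (rule bexE)
      then have gX: "g \<in> X" "?P g = g" unfolding Z by auto
      have fg: "f - g \<in> X" using X_diff f gX by blast
      have gen: "a - f = b - (f - g)" if "a = b + g" for a b using that by simp
      have "f = (f - g) + g" by simp
      then have "?P f = ?P ((f - g) + g)" by (rule arg_cong)
      also have "\<dots> = ?P (f - g) + g" using Padd[OF fg gX(1)] by (simp only: gX(2))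
      finally have "?P f = ?P (f - g) + g" .
      then have eq: "?P f - f = ?P (f - g) - (f - g)" by (rule gen)
      have "gn (?P f - f) \<le> gn (?P (f - g)) + gn (f - g)"
        unfolding eq by (rule X_diff(2)[OF SX[OF QW[OF fg]] fg])
      also have "\<dots> \<le> \<bar>C * D\<bar> * gn (f - g) + gn (f - g)"
        using Pbd[OF fg] mult_right_mono[OF abs_ge_self[of "C * D"] gn_nonneg[of "f - g"]] by linarith
      also have "\<dots> = (\<bar>C * D\<bar> + 1) * gn (f - g)" by (simp add: algebra_simps)
      also have "\<dots> \<le> (\<bar>C * D\<bar> + 1) * e" using g by (intro mult_left_mono) auto
      finally show ?thesis .
    qed
    have "gn (?P f - f) \<le> 0"
    proof (rule field_le_epsilon)
      fix e :: real assume "e > 0"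
      then show "gn (?P f - f) \<le> 0 + e"
        using bound[of "e / (\<bar>C * D\<bar> + 1)"] by (simp add: add_pos_nonneg add_nonneg_pos)
    qed
    then have "gn (?P f - f) = 0" using gn_nonneg[of "?P f - f"] by linarith
    then have "?P f - f = 0" using gn_eq_0 X_diff(1)[OF SX[OF QW[OF f]] f] by blast
    then show "f \<in> ?Z" using f Z by auto
  qed
  have "?P ` X = ?Z" using QW Z by force
  then show "C_complemented (C * D) garling_sp ?Z"
    unfolding C_complemented_def using cl Plin Pbd QS QW by (intro conjI exI[of _ ?P]) auto
  have "bounded_linear_map (subspace_as_space garling_sp ?Z) W Q"
    unfolding bounded_linear_map_def linear_map_def subspace_as_space_def
  proof (intro conjI exI[of _ D])
    have "?Z \<subseteq> X" using SX by auto
    then show "Q \<in> carrier (garling_sp\<lparr>carrier := ?Z\<rparr>) \<rightarrow> carrier W" using QW by auto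
    show "\<forall>f\<in>carrier (garling_sp\<lparr>carrier := ?Z\<rparr>). nrm W (Q f) \<le> D * nrm (garling_sp\<lparr>carrier := ?Z\<rparr>) f"
      using DQ SX by simp
  qed (use Qadd Qsc SX in simp_all)
  moreover have "bounded_linear_map W (subspace_as_space garling_sp ?Z) S"
    unfolding bounded_linear_map_def linear_map_def subspace_as_space_def
    by (intro conjI exI[of _ C]) (use Sadd Ssc CS in simp_all)
  ultimately show "subspace_as_space garling_sp ?Z \<approx> W"
    unfolding isomorphic_spaces_def using QS Z
    by (intro exI[of _ Q] exI[of _ S]) (auto simp: subspace_as_space_def)
qed

section \<open>Tails of sequences in the Garling space\<close>

text \<open>The vector \<open>f\<close> with its first \<open>n\<close> entries replaced by zero.\<close>

definition tail_from :: "nat \<Rightarrow> (nat \<Rightarrow> 'a::{real_normed_field,banach}) \<Rightarrow> nat \<Rightarrow> 'a"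
  where "tail_from n f = (\<lambda>i. if n \<le> i then f i else 0)"

lemma tail_from_X: assumes "f \<in> X" shows "tail_from n f \<in> X" "gn (tail_from n f) \<le> gn f"
  using X_mono[OF assms, of "tail_from n f"] by (auto simp: tail_from_def)

lemma sum_w_tendsto: "filterlim (\<lambda>N. \<Sum>j<N. w j) at_top sequentially"
proof -
  have "\<exists>N. (\<Sum>j<N. w j) > M" for M
  proof (rule ccontr)
    assume "\<not> (\<exists>N. (\<Sum>j<N. w j) > M)"
    then have "(\<Sum>k\<le>n. w k) \<le> M" for n
      unfolding lessThan_Suc_atMost[symmetric] by (simp only: not_ex not_less)
    then show False using bounded_imp_summable[of w M] w_not_summable w_nonneg by blast
  qed
  moreover have "(\<Sum>j<m. w j) \<le> (\<Sum>j<n. w j)" if "m \<le> n" for m n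
    using that by (intro sum_mono2) (auto simp: w_nonneg)
  ultimately show ?thesis
    unfolding filterlim_at_top eventually_sequentially by (meson less_le order_trans)
qed

lemma power_sum_ge_const:
  assumes "finite A" "\<And>a. a \<in> A \<Longrightarrow> norm (f a) \<ge> e" "e \<ge> 0"
  shows "(\<Sum>a\<in>A. norm (f a) powr p * w (rk A a)) \<ge> e powr p * (\<Sum>j<card A. w j)"
proof -
  have "e powr p * (\<Sum>j<card A. w j) = (\<Sum>a\<in>A. e powr p * w (rk A a))"
    by (simp add: sum_rk[OF assms(1), symmetric] sum_distrib_left)
  also have "\<dots> \<le> (\<Sum>a\<in>A. norm (f a) powr p * w (rk A a))"
    using assms p by (intro sum_mono mult_right_mono powr_mono2) (auto simp: w_nonneg)
  finally show ?thesis .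
qed

text \<open>This uses that the weights are not summable.\<close>

lemma X_c0:
  assumes f: "f \<in> X" shows "f \<longlonglongrightarrow> 0"
proof (rule ccontr)
  assume "\<not> f \<longlonglongrightarrow> 0"
  then obtain e where e: "e > 0" "\<And>n. \<exists>i\<ge>n. norm (f i) \<ge> e"
    unfolding lim_sequentially by (auto simp: not_less dist_norm)
  let ?I = "{i. norm (f i) \<ge> e}"
  have inf: "infinite ?I"
    unfolding infinite_nat_iff_unbounded_le using e(2) by auto
  have bound: "e powr p * (\<Sum>j<N. w j) \<le> gn f powr p" for N
  proof -
    obtain A where A: "finite A" "card A = N" "A \<subseteq> ?I" using infinite_arbitrarily_large[OF inf] by blast
    then show ?thesis
      using power_sum_ge_const[of A e f] gn_powr_ge[OF f A(1)] e(1) by fastforce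
  qed
  obtain N where "(\<Sum>j<N. w j) > gn f powr p / e powr p"
    using sum_w_tendsto unfolding filterlim_at_top_dense eventually_sequentially by blast
  then show False using bound[of N] e(1) by (simp add: field_simps)
qed

text \<open>Moving a finite set \<open>N\<close> positions to the right costs little when the entries are small,
  because the losses \<open>w j - w (N + j)\<close> telescope.\<close>

lemma shift_loss:
  assumes "finite B" and s: "\<And>b. b \<in> B \<Longrightarrow> norm (f b) powr p \<le> s" "s \<ge> 0"
  shows "(\<Sum>b\<in>B. norm (f b) powr p * w (rk B b)) - real N * s
           \<le> (\<Sum>b\<in>B. norm (f b) powr p * w (N + rk B b))"
proof -
  have "(\<Sum>b\<in>B. norm (f b) powr p * w (rk B b)) - (\<Sum>b\<in>B. norm (f b) powr p * w (N + rk B b))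
      = (\<Sum>b\<in>B. norm (f b) powr p * (w (rk B b) - w (N + rk B b)))"
    by (simp add: sum_subtractf right_diff_distrib)
  also have "\<dots> \<le> (\<Sum>b\<in>B. s * (w (rk B b) - w (N + rk B b)))"
    using s by (intro sum_mono mult_right_mono) (auto simp: w_antimono)
  also have "\<dots> = s * (\<Sum>j<card B. w j - w (N + j))"
    by (simp add: sum_rk[OF assms(1), symmetric] sum_distrib_left)
  also have "\<dots> \<le> s * real N"
  proof (rule mult_left_mono)
    have "(\<Sum>j<card B. w j) \<le> (\<Sum>j<N + card B. w j)"
      by (intro sum_mono2) (auto simp: w_nonneg)
    also have "\<dots> = (\<Sum>j<N. w j) + (\<Sum>j<card B. w (N + j))"
    proof -
      have "(\<Sum>j<N + c. w j) = (\<Sum>j<N. w j) + (\<Sum>j<c. w (N + j))" for c by (induction c) auto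
      then show ?thesis .
    qed
    also have "(\<Sum>j<N. w j) \<le> (\<Sum>j<N. 1)" by (intro sum_mono w_le_1)
    finally show "(\<Sum>j<card B. w j - w (N + j)) \<le> real N" by (simp add: sum_subtractf)
  qed (fact s(2))
  finally show ?thesis by (simp add: mult.commute)
qed

text \<open>If all tails had norm above \<open>e\<close>, infinitely many finite sets norming them could be
  concatenated. The entries tend to zero, so each set can be chosen so far to the right that shifting
  it behind the previous ones loses at most half of \<open>e powr p\<close>.\<close>

lemma tail_from_tendsto:
  assumes f: "f \<in> X" and "e > 0"
  shows "\<exists>n0. \<forall>n\<ge>n0. gn (tail_from n f) \<le> e"
proof (rule ccontr)
  assume "\<not> (\<exists>n0. \<forall>n\<ge>n0. gn (tail_from n f) \<le> e)"
  moreover have "gn (tail_from n f) \<le> gn (tail_from m f)" if "m \<le> n" for m n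
    using X_mono(2)[OF tail_from_X(1)[OF f], of "tail_from n f" m] that by (auto simp: tail_from_def)
  ultimately have big: "gn (tail_from n f) > e" for n
    by (meson less_le_trans linorder_not_le)
  let ?G = "\<lambda>A. \<Sum>a\<in>A. norm (f a) powr p * w (rk A a)"
  have ep: "e powr p > 0" using assms by simp
  have "\<exists>A. finite A \<and> ?G A \<ge> real K * (e powr p / 2)" for K
  proof (induction K)
    case 0
    show ?case by (rule exI[of _ "{}"]) simp
  next
    case (Suc K)
    then obtain A where A: "finite A" "?G A \<ge> real K * (e powr p / 2)" by blast
    define s where "s = e powr p / (2 * (card A + 1))"
    have s: "s > 0" using ep by (simp add: s_def)
    have "((\<lambda>i. norm (f i) powr p) \<longlongrightarrow> 0) sequentially"
      using tendsto_powr'[OF tendsto_norm_zero[OF X_c0[OF f]], of "\<lambda>_. p" p] p by auto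
    then obtain n1 where n1: "\<And>i. i \<ge> n1 \<Longrightarrow> norm (f i) powr p < s"
      using s unfolding lim_sequentially by (auto simp: dist_norm)
    obtain n2 where n2: "A \<subseteq> {..<n2}" using A(1) finite_nat_set_iff_bounded by auto
    define n where "n = max n1 n2"
    have "\<exists>B0. finite B0 \<and> sn B0 (tail_from n f) > e"
    proof (rule ccontr)
      assume "\<not> ?thesis"
      then have "gn (tail_from n f) \<le> e" using assms(2) by (intro garlingI) (auto simp: not_less)
      then show False using big[of n] by simp
    qed
    then obtain B0 where B0: "finite B0" "sn B0 (tail_from n f) > e" by blast
    define B where "B = B0 \<inter> {n..}"
    have B: "finite B" "B \<subseteq> {n..}" using B0 by (auto simp: B_def)
    have "e powr p \<le> (sn B0 (tail_from n f)) powr p" using B0 assms p by (intro powr_mono2) auto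
    also have "\<dots> = (\<Sum>b\<in>B0. norm (tail_from n f b) powr p * w (rk B0 b))" by (rule sn_powr)
    also have "\<dots> = (\<Sum>b\<in>B. norm (f b) powr p * w (rk B0 b))"
      using p by (intro sum.mono_neutral_cong_right) (auto simp: B_def B0 tail_from_def)
    also have "\<dots> \<le> ?G B"
      by (intro sum_mono mult_left_mono w_antimono rk_mono_set) (auto simp: B_def)
    finally have GB: "?G B \<ge> e powr p" .
    have sB: "norm (f b) powr p \<le> s" if "b \<in> B" for b
      using n1[of b] B(2) that by (force simp: n_def)
    have An: "A \<subseteq> {..<n}" using n2 by (auto simp: n_def)
    then have disj: "A \<inter> B = {}" using B(2) by fastforce
    have "?G (A \<union> B) = (\<Sum>a\<in>A. norm (f a) powr p * w (rk (A \<union> B) a))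
        + (\<Sum>b\<in>B. norm (f b) powr p * w (rk (A \<union> B) b))"
      using A B disj by (simp add: sum.union_disjoint)
    also have "(\<Sum>a\<in>A. norm (f a) powr p * w (rk (A \<union> B) a)) = ?G A"
      by (intro sum.cong refl) (simp add: rk_append_left[OF An B(2)])
    also have "(\<Sum>b\<in>B. norm (f b) powr p * w (rk (A \<union> B) b))
        = (\<Sum>b\<in>B. norm (f b) powr p * w (card A + rk B b))"
      by (intro sum.cong refl) (simp add: rk_append[OF A(1) An B(2)])
    finally have GAB: "?G (A \<union> B) = ?G A + (\<Sum>b\<in>B. norm (f b) powr p * w (card A + rk B b))" .
    have "real (card A) * s \<le> e powr p / 2" using ep by (simp add: s_def field_simps)
    moreover have "?G B - real (card A) * s \<le> (\<Sum>b\<in>B. norm (f b) powr p * w (card A + rk B b))"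
      using sB s by (intro shift_loss[OF B(1)]) auto
    moreover have "real (Suc K) * (e powr p / 2) = real K * (e powr p / 2) + e powr p / 2"
      by (simp add: distrib_right)
    ultimately have "?G (A \<union> B) \<ge> real (Suc K) * (e powr p / 2)"
      using GAB A(2) GB by linarith
    then show ?case using A B by (intro exI[of _ "A \<union> B"]) auto
  qed
  then have "real K * (e powr p / 2) \<le> gn f powr p" for K
    using gn_powr_ge[OF f] by (meson order_trans)
  moreover obtain K :: nat where "real K > gn f powr p / (e powr p / 2)"
    using reals_Archimedean2 by blast
  ultimately show False using ep by (smt (verit, best) half_gt_zero pos_divide_less_eq)
qed

end

section \<open>Almost disjoint blocks spanning copies of \<open>\<ell>\<^sub>p\<close>\<close>

lemma sum_half_powers: "(\<Sum>k<N. (1/2) ^ k) \<le> (2::real)"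
proof -
  have "(\<Sum>k<N. (1/2) ^ k) = 2 - 2 * (1/2::real) ^ N" by (induction N) auto
  then show ?thesis by simp
qed

context garling begin

text \<open>The \<open>\<ell>\<^sub>p\<close>-norm of the first \<open>N\<close> entries.\<close>

abbreviation lp_part :: "nat \<Rightarrow> (nat \<Rightarrow> 'a::{real_normed_field,banach}) \<Rightarrow> real"
  where "lp_part N b \<equiv> wlp p {..<N} (\<lambda>_. 1) b"

abbreviation lpn :: "(nat \<Rightarrow> 'a::{real_normed_field,banach}) \<Rightarrow> real"
  where "lpn \<equiv> nrm (lp_space p)"

abbreviation Lp :: "(nat \<Rightarrow> 'a::{real_normed_field,banach}) set"
  where "Lp \<equiv> carrier (lp_space p)"

lemma lpI:
  assumes "M \<ge> 0" "\<And>N. lp_part N b \<le> M"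
  shows "b \<in> Lp" "lpn b \<le> M"
proof -
  have le: "(\<Sum>k<N. norm (b k) powr p) \<le> M powr p" for N
    using assms(2)[of N] by (subst (asm) wlp_le_iff) (auto simp: p assms)
  have sum: "summable (\<lambda>k. norm (b k) powr p)"
    using le by (intro summableI_nonneg_bounded[of _ "M powr p"]) auto
  then show "b \<in> Lp" by (simp add: lp_space_def)
  have "(\<Sum>k. norm (b k) powr p) \<le> M powr p" using le by (intro suminf_le_const sum)
  then have "(\<Sum>k. norm (b k) powr p) powr (1/p) \<le> (M powr p) powr (1/p)"
    using p by (intro powr_mono2 suminf_nonneg sum) auto
  then show "lpn b \<le> M" using powr_inverse_powr[OF assms(1) p] by (simp add: lp_space_def)
qed

lemma lp_part_le_lpn: assumes "b \<in> Lp" shows "lp_part N b \<le> lpn b"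
proof -
  have "(\<Sum>k<N. norm (b k) powr p) \<le> (\<Sum>k. norm (b k) powr p)"
    using assms by (intro sum_le_suminf) (auto simp: lp_space_def)
  then show ?thesis
    using p by (auto simp: wlp_def lp_space_def intro!: powr_mono2 sum_nonneg)
qed

lemma coord_le_lp_part: assumes "k < N" shows "norm (b k) \<le> lp_part N b"
proof -
  have "norm (b k) powr p \<le> (\<Sum>k<N. norm (b k) powr p)"
    using assms by (intro member_le_sum) auto
  then have "(norm (b k) powr p) powr (1/p) \<le> lp_part N b"
    using p by (auto simp: wlp_def intro!: powr_mono2)
  then show ?thesis using powr_inverse_powr[of "norm (b k)" p] p by simp
qed

lemma lpn_nonneg: "lpn b \<ge> 0" by (simp add: lp_space_def)

lemma Lp_tail_small:
  assumes b: "b \<in> Lp" and "e > 0"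
  shows "\<exists>N. (\<lambda>k. if N \<le> k then b k else 0) \<in> Lp \<and> lpn (\<lambda>k. if N \<le> k then b k else 0) \<le> e"
proof -
  have sm: "summable (\<lambda>k. norm (b k) powr p)" using b by (simp add: lp_space_def)
  obtain N where N: "norm (\<Sum>i. norm (b (i + N)) powr p) < e powr p"
    using suminf_exist_split[OF _ sm, of "e powr p"] assms(2) by auto
  let ?t = "\<lambda>k. if N \<le> k then b k else 0"
  have "lp_part M ?t \<le> e" for M
  proof -
    have "(\<Sum>k<M. norm (?t k) powr p) = (\<Sum>k\<in>{..<M} \<inter> {N..}. norm (b k) powr p)"
      using p by (intro sum.mono_neutral_cong_right) auto
    also have "\<dots> \<le> (\<Sum>k\<in>{N..<N+M}. norm (b k) powr p)" by (intro sum_mono2) auto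
    also have "\<dots> = (\<Sum>i<M. norm (b (i + N)) powr p)"
      using sum.shift_bounds_nat_ivl[of "\<lambda>k. norm (b k) powr p" 0 N M]
      by (simp add: add.commute atLeast0LessThan)
    also have "\<dots> \<le> (\<Sum>i. norm (b (i + N)) powr p)"
      by (intro sum_le_suminf) (use sm in \<open>auto simp: summable_iff_shift[of "\<lambda>k. norm (b k) powr p"]\<close>)
    also have "\<dots> \<le> e powr p" using N by simp
    finally show ?thesis using assms(2) p by (subst wlp_le_iff) auto
  qed
  then show ?thesis using lpI[of e ?t] assms(2) by (intro exI[of _ N]) auto
qed

end

text \<open>A sequence \<open>v\<close> of unit vectors, each supported up to a small tail in its interval
  \<open>[n k, n (Suc k))\<close>. The set \<open>F k\<close> carries three quarters of the norm, to the power \<open>p\<close>, and the entries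
  are so small that half is left after a shift by \<open>n k\<close> positions.\<close>

locale block_system = garling w p for w p +
  fixes n :: "nat \<Rightarrow> nat" and v :: "nat \<Rightarrow> nat \<Rightarrow> 'a::{real_normed_field,banach}"
    and F :: "nat \<Rightarrow> nat set"
  assumes n_mono: "strict_mono n"
    and v_X: "v k \<in> X" and v_norm: "gn (v k) = 1"
    and v_zero: "i < n k \<Longrightarrow> v k i = 0"
    and F_sub: "F k \<subseteq> {n k..<n (Suc k)}"
    and F_norming: "(\<Sum>a\<in>F k. norm (v k a) powr p * w (rk (F k) a)) \<ge> 3/4"
    and v_small: "real (n k) * norm (v k i) powr p \<le> 1/4"
    and v_tail: "gn (tail_from (n (Suc k)) (v k)) \<le> (1/2) ^ k / 8"
begin

lemma F_finite: "finite (F k)"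
  using F_sub finite_subset by blast

lemma n_le: "j \<le> k \<Longrightarrow> n j \<le> n k"
  using n_mono by (simp add: strict_mono_less_eq)

lemma le_n: "k \<le> n k"
  using n_mono by (rule strict_mono_imp_increasing)

subsection \<open>The synthesis operator\<close>

text \<open>The series with coefficients \<open>b\<close>. Since \<open>v k\<close> vanishes below \<open>n k \<ge> k\<close>, only finitely many terms
  contribute to each coordinate, so the series is summed pointwise.\<close>

definition synth :: "(nat \<Rightarrow> 'a) \<Rightarrow> nat \<Rightarrow> 'a"
  where "synth b = (\<lambda>i. \<Sum>k\<le>i. b k * v k i)"

lemma v_zero': "i < k \<Longrightarrow> v k i = 0"
  using v_zero le_n[of k] by simp

lemma synth_eq: "i < N \<Longrightarrow> synth b i = (\<Sum>k<N. b k * v k i)"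
  unfolding synth_def by (intro sum.mono_neutral_left) (auto simp: v_zero')

lemma synth_add: "synth (b + c) = synth b + synth c"
  by (auto simp: synth_def fun_eq_iff sum.distrib distrib_right)

lemma synth_scale: "synth (seq_scale c b) = seq_scale c (synth b)"
  by (auto simp: synth_def fun_eq_iff seq_scale_def sum_distrib_left mult.assoc)

abbreviation body :: "nat \<Rightarrow> nat \<Rightarrow> 'a"
  where "body k \<equiv> (\<lambda>i. if i < n (Suc k) then v k i else 0)"

lemma body_disjoint: assumes "j \<noteq> k" shows "body j i = 0 \<or> body k i = 0"
proof -
  have "body j i = 0 \<or> body k i = 0" if "j < k" for j k
    using v_zero[of i k] n_le[of "Suc j" k] that by auto
  then show ?thesis using assms by (metis linorder_neqE_nat)
qed

lemma powr_sum_body: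
  "norm (\<Sum>k<N. b k * body k i) powr p = (\<Sum>k<N. norm (b k) powr p * norm (body k i) powr p)"
proof (cases "\<exists>j<N. body j i \<noteq> 0")
  case True
  then obtain j where j: "j < N" "body j i \<noteq> 0" by blast
  then have z: "body k i = 0" if "k \<noteq> j" for k using body_disjoint[OF that, of i] by blast
  have "(\<Sum>k<N. b k * body k i) = b j * body j i"
    using j z by (subst sum.remove[of _ j]) (auto intro!: sum.neutral)
  moreover have "(\<Sum>k<N. norm (b k) powr p * norm (body k i) powr p)
      = norm (b j) powr p * norm (body j i) powr p"
  proof (subst sum.remove[of _ j])
    have "(\<Sum>k\<in>{..<N} - {j}. norm (b k) powr p * norm (body k i) powr p) = 0"
      using z p by (intro sum.neutral) (metis DiffE insertI1 mult_zero_right norm_zero powr_0)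
    then show "norm (b j) powr p * norm (body j i) powr p
       + (\<Sum>k\<in>{..<N} - {j}. norm (b k) powr p * norm (body k i) powr p)
       = norm (b j) powr p * norm (body j i) powr p" by simp
  qed (use j in auto)
  ultimately show ?thesis by (simp only: norm_mult powr_mult norm_ge_zero)
next
  case False
  then have z: "body k i = 0" if "k < N" for k using that by blast
  have "(\<Sum>k<N. b k * body k i) = 0" using z by (intro sum.neutral) (metis lessThan_iff mult_zero_right)
  moreover have "(\<Sum>k<N. norm (b k) powr p * norm (body k i) powr p) = 0"
    using z by (intro sum.neutral) (metis lessThan_iff mult_zero_right norm_zero powr_0)
  ultimately show ?thesis by simp
qed

text \<open>The bodies are disjointly supported and satisfy an upper \<open>\<ell>\<^sub>p\<close>-estimate with constant one. The
  tails add at most \<open>lpn b\<close>, since their norms are summable.\<close>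

lemma synth_bound:
  assumes b: "b \<in> Lp"
  shows "synth b \<in> X" "gn (synth b) \<le> 2 * lpn b"
proof -
  have "sn A (synth b) \<le> 2 * lpn b" if A: "finite A" for A
  proof -
    obtain N where N: "\<And>a. a \<in> A \<Longrightarrow> a < N" using A finite_nat_set_iff_bounded by auto
    let ?g = "\<Sum>k<N. seq_scale (b k) (body k)"
    let ?r = "\<lambda>k. tail_from (n (Suc k)) (v k)"
    let ?h = "\<Sum>k<N. seq_scale (b k) (?r k)"
    have "sn A (synth b) = sn A (?g + ?h)"
    proof (rule sn_cong)
      fix a assume "a \<in> A"
      have "(\<Sum>k<N. b k * v k a) = (\<Sum>k<N. b k * body k a + b k * ?r k a)"
        by (intro sum.cong refl) (simp add: tail_from_def)
      then have "(\<Sum>k<N. b k * v k a) = (\<Sum>k<N. b k * body k a) + (\<Sum>k<N. b k * ?r k a)"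
        by (simp only: sum.distrib)
      then show "synth b a = (?g + ?h) a"
        using synth_eq[OF N[OF \<open>a \<in> A\<close>], of b] by (simp add: sum_fun_apply seq_scale_def)
    qed
    also have "\<dots> \<le> sn A ?g + sn A ?h" by (rule sn_triangle)
    also have "sn A ?g \<le> lpn b"
    proof (subst sn_le_iff[OF lpn_nonneg])
      have "(\<Sum>a\<in>A. norm (?g a) powr p * w (rk A a))
          = (\<Sum>a\<in>A. \<Sum>k<N. norm (b k) powr p * (norm (body k a) powr p * w (rk A a)))"
        unfolding sum_fun_apply seq_scale_def powr_sum_body by (simp only: sum_distrib_right mult.assoc)
      also have "\<dots> = (\<Sum>k<N. norm (b k) powr p * (\<Sum>a\<in>A. norm (body k a) powr p * w (rk A a)))"
        by (subst sum.swap) (simp only: sum_distrib_left)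
      also have "\<dots> \<le> (\<Sum>k<N. norm (b k) powr p * 1)"
      proof (intro sum_mono mult_left_mono)
        fix k
        have "(\<Sum>a\<in>A. norm (body k a) powr p * w (rk A a)) \<le> (\<Sum>a\<in>A. norm (v k a) powr p * w (rk A a))"
          using p by (intro sum_mono mult_right_mono powr_mono2) (auto simp: w_nonneg)
        also have "\<dots> \<le> gn (v k) powr p" by (rule gn_powr_ge[OF v_X A])
        finally show "(\<Sum>a\<in>A. norm (body k a) powr p * w (rk A a)) \<le> 1" by (simp add: v_norm)
      qed auto
      also have "\<dots> \<le> lpn b powr p"
        using lp_part_le_lpn[OF b, of N] by (subst (asm) wlp_le_iff) (auto simp: p lpn_nonneg)
      finally show "(\<Sum>a\<in>A. norm (?g a) powr p * w (rk A a)) \<le> lpn b powr p" .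
    qed
    also have "sn A ?h \<le> lpn b"
    proof -
      have "sn A ?h \<le> (\<Sum>k<N. sn A (seq_scale (b k) (?r k)))" by (rule sn_sum)
      also have "\<dots> \<le> (\<Sum>k<N. lpn b * ((1/2) ^ k / 8))"
      proof (rule sum_mono)
        fix k assume "k \<in> {..<N}"
        then have "norm (b k) \<le> lpn b"
          using coord_le_lp_part[of k N b] lp_part_le_lpn[OF b, of N] by simp
        moreover have "sn A (?r k) \<le> (1/2) ^ k / 8"
          using sn_le_gn[OF tail_from_X(1)[OF v_X] A] v_tail by (rule order_trans)
        ultimately show "sn A (seq_scale (b k) (?r k)) \<le> lpn b * ((1/2) ^ k / 8)"
          unfolding sn_scale by (intro mult_mono) (auto simp: lpn_nonneg)
      qed
      also have "\<dots> = lpn b * ((\<Sum>k<N. (1/2) ^ k) / 8)"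
        by (simp only: sum_distrib_left sum_divide_distrib)
      also have "\<dots> \<le> lpn b * 1"
        using sum_half_powers[of N] by (intro mult_left_mono) (auto simp: lpn_nonneg)
      finally show ?thesis by simp
    qed
    finally show ?thesis by simp
  qed
  then show "synth b \<in> X" "gn (synth b) \<le> 2 * lpn b"
    using garlingI[of "2 * lpn b" "synth b"] lpn_nonneg[of b] by auto
qed

lemma synth_linear: "linear_map (lp_space p) garling_sp synth"
  unfolding linear_map_def using synth_add synth_scale synth_bound by auto

lemma synth_finite: "synth (\<lambda>k. if k < N then b k else 0) = (\<Sum>k<N. seq_scale (b k) (v k))"
proof
  fix i
  let ?N = "N + i + 1"
  have "synth (\<lambda>k. if k < N then b k else 0) i = (\<Sum>k<?N. (if k < N then b k else 0) * v k i)"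
    by (rule synth_eq) simp
  also have "\<dots> = (\<Sum>k<N. b k * v k i)"
    by (intro sum.mono_neutral_cong_right) auto
  finally show "synth (\<lambda>k. if k < N then b k else 0) i = (\<Sum>k<N. seq_scale (b k) (v k)) i"
    by (simp add: sum_fun_apply seq_scale_def)
qed

lemma synth_in_closed:
  assumes V: "closed_subspace garling_sp V" and vV: "\<And>k. v k \<in> V" and b: "b \<in> Lp"
  shows "synth b \<in> V"
proof -
  have "\<exists>g\<in>V. gn (synth b - g) < e" if "e > 0" for e
  proof -
    have "e / 4 > 0" using that by simp
    from Lp_tail_small[OF b this] obtain N where N: "(\<lambda>k. if N \<le> k then b k else 0) \<in> Lp"
        "lpn (\<lambda>k. if N \<le> k then b k else 0) \<le> e / 4"
      by (elim exE conjE)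
    let ?t = "\<lambda>k. if N \<le> k then b k else 0" and ?h = "\<lambda>k. if k < N then b k else 0"
    have "b = ?h + ?t" by (auto simp: fun_eq_iff)
    then have "synth b = synth ?h + synth ?t" by (metis synth_add)
    then have "synth b - synth ?h = synth ?t" by simp
    moreover have "gn (synth ?t) < e" using synth_bound(2)[OF N(1)] N(2) that by linarith
    moreover have "synth ?h \<in> V" unfolding synth_finite
      using V vV by (intro seq.subspace_sum seq.subspace_scale) (auto simp: closed_subspace_def)
    ultimately show ?thesis by metis
  qed
  then show ?thesis using V synth_bound(1)[OF b] unfolding closed_subspace_iff by blast
qed

subsection \<open>The coefficient functionals\<close>

text \<open>What remains of the power sum of \<open>v j\<close> over \<open>F j\<close> after the shift by \<open>n j\<close> positions.\<close>

definition mass :: "nat \<Rightarrow> real"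
  where "mass j = (\<Sum>a\<in>F j. norm (v j a) powr p * w (n j + rk (F j) a))"

lemma mass_ge: "mass j \<ge> 1/2"
proof (cases "n j = 0")
  case True
  then show ?thesis using F_norming[of j] by (simp add: mass_def)
next
  case False
  have "norm (v j b) powr p \<le> 1 / (4 * real (n j))" for b
    using v_small[of j b] False by (simp add: field_simps)
  then have "(\<Sum>b\<in>F j. norm (v j b) powr p * w (rk (F j) b)) - real (n j) * (1 / (4 * real (n j)))
      \<le> mass j"
    unfolding mass_def by (intro shift_loss F_finite) auto
  then show ?thesis using F_norming[of j] False by simp
qed

text \<open>Probability weights on \<open>F j\<close>.\<close>

definition mu :: "nat \<Rightarrow> nat \<Rightarrow> real"
  where "mu j a = norm (v j a) powr p * w (n j + rk (F j) a) / mass j"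

text \<open>The average over \<open>F j\<close>, with respect to the probability weights \<open>mu j\<close>, of the ratios of the
  entries of \<open>f\<close> to those of \<open>v j\<close>. Points where \<open>v j\<close> vanishes have weight zero.\<close>

definition q :: "nat \<Rightarrow> (nat \<Rightarrow> 'a) \<Rightarrow> 'a"
  where "q j f = (\<Sum>a\<in>F j. of_real (mu j a) * (f a / v j a))"

lemma mu_nonneg: "mu j a \<ge> 0"
  using mass_ge[of j] by (auto simp: mu_def w_nonneg)

lemma sum_mu: "(\<Sum>a\<in>F j. mu j a) = 1"
  using mass_ge[of j] by (simp add: mu_def sum_divide_distrib[symmetric]) (simp add: mass_def)

lemma q_add: "q j (f + g) = q j f + q j g"
  by (simp add: q_def add_divide_distrib distrib_left sum.distrib)

lemma q_scale: "q j (seq_scale c f) = c * q j f"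
  by (simp add: q_def seq_scale_def sum_distrib_left mult_ac)

lemma q_sum: "q j (\<Sum>k\<in>I. g k) = (\<Sum>k\<in>I. q j (g k))"
proof (induction I rule: infinite_finite_induct)
  case (insert x I)
  have "q j (\<Sum>k\<in>insert x I. g k) = q j (g x + sum g I)" using insert.hyps by simp
  also have "\<dots> = q j (g x) + q j (sum g I)" by (rule q_add)
  also have "\<dots> = (\<Sum>k\<in>insert x I. q j (g k))" using insert by simp
  finally show ?case .
qed (simp_all add: q_def)

lemma q_cong: "(\<And>a. a \<in> F j \<Longrightarrow> f a = g a) \<Longrightarrow> q j f = q j g"
  by (simp add: q_def)

lemma q_self: "q j (v j) = 1"
proof -
  have "q j (v j) = (\<Sum>a\<in>F j. of_real (mu j a))"
    unfolding q_def by (intro sum.cong refl) (auto simp: mu_def)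
  then show ?thesis by (metis of_real_1 of_real_sum sum_mu)
qed

lemma q_powr_le:
  "norm (q j f) powr p \<le> 2 * (\<Sum>a\<in>F j. norm (f a) powr p * w (n j + rk (F j) a))"
proof -
  let ?x = "\<lambda>a. norm (f a) / norm (v j a)"
  \<comment> \<open>Jensen's inequality for \<open>\<lambda>x. x powr p\<close> and the probability weights \<open>mu j\<close>\<close>
  have "norm (q j f) \<le> (\<Sum>a\<in>F j. mu j a * ?x a)"
    unfolding q_def using mu_nonneg
    by (intro sum_norm_le) (simp add: norm_mult norm_divide)
  then have "norm (q j f) powr p \<le> (\<Sum>a\<in>F j. mu j a *\<^sub>R ?x a) powr p"
    using p by (intro powr_mono2) auto
  also have "\<dots> \<le> (\<Sum>a\<in>F j. mu j a * ?x a powr p)"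
  proof (rule convex_on_sum[OF F_finite _ powr_convex_nonneg[OF p] sum_mu mu_nonneg])
    show "F j \<noteq> {}" using sum_mu[of j] by auto
  qed auto
  also have "\<dots> \<le> (\<Sum>a\<in>F j. 2 * (norm (f a) powr p * w (n j + rk (F j) a)))"
  proof (rule sum_mono)
    fix a
    let ?u = "w (n j + rk (F j) a)"
    show "mu j a * ?x a powr p \<le> 2 * (norm (f a) powr p * ?u)"
    proof (cases "v j a = 0")
      case False
      then have "mu j a * ?x a powr p = norm (f a) powr p * ?u / mass j"
        by (simp add: mu_def powr_divide)
      also have "\<dots> \<le> norm (f a) powr p * ?u / (1/2)"
        using mass_ge[of j] by (intro divide_left_mono) (auto simp: w_nonneg)
      finally show ?thesis by simp
    qed (simp add: mu_def w_nonneg)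
  qed
  finally show ?thesis by (simp add: sum_distrib_left)
qed

text \<open>The sets \<open>F j\<close> are consecutive, and the position of \<open>a \<in> F j\<close> in their union is at most
  \<open>n j + rk (F j) a\<close>.\<close>

lemma q_lp_part_le:
  assumes f: "f \<in> X"
  shows "lp_part N (\<lambda>j. q j f) \<le> 2 * gn f"
proof (subst wlp_le_iff)
  let ?A = "\<Union>j<N. F j"
  have disj: "F i \<inter> F j = {}" if "i \<noteq> j" for i j
    using F_sub[of i] F_sub[of j] n_le[of "Suc i" j] n_le[of "Suc j" i] that
    by (cases "i < j") (force simp: Suc_le_eq)+
  have rk: "rk ?A a \<le> n j + rk (F j) a" if "a \<in> F j" for j a
  proof -
    have "{b \<in> ?A. b < a} \<subseteq> {..<n j} \<union> {b \<in> F j. b < a}"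
    proof
      fix b assume "b \<in> {b \<in> ?A. b < a}"
      then obtain i where i: "b \<in> F i" "b < a" by auto
      have "i \<le> j"
      proof (rule ccontr)
        assume "\<not> i \<le> j"
        then show False using n_le[of "Suc j" i] F_sub[of i] F_sub[of j] i that by fastforce
      qed
      then show "b \<in> {..<n j} \<union> {b \<in> F j. b < a}"
        using n_le[of "Suc i" j] F_sub[of i] i by (cases "i = j") fastforce+
    qed
    then have "rk ?A a \<le> card ({..<n j} \<union> {b \<in> F j. b < a})"
      unfolding rk_def using F_finite by (intro card_mono) auto
    also have "\<dots> \<le> n j + rk (F j) a" unfolding rk_def by (rule order_trans[OF card_Un_le]) simp
    finally show ?thesis .
  qed
  have "(\<Sum>j<N. norm (q j f) powr p * 1)
      \<le> (\<Sum>j<N. 2 * (\<Sum>a\<in>F j. norm (f a) powr p * w (n j + rk (F j) a)))"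
    using q_powr_le by (intro sum_mono) simp
  also have "\<dots> \<le> (\<Sum>j<N. 2 * (\<Sum>a\<in>F j. norm (f a) powr p * w (rk ?A a)))"
    using rk by (intro sum_mono mult_left_mono w_antimono) auto
  also have "\<dots> = 2 * (\<Sum>a\<in>?A. norm (f a) powr p * w (rk ?A a))"
    using disj F_finite by (subst sum.UNION_disjoint) (auto simp: sum_distrib_left)
  also have "\<dots> \<le> 2 * gn f powr p"
    using F_finite by (intro mult_left_mono gn_powr_ge f) auto
  also have "\<dots> \<le> 2 powr p * gn f powr p"
    using p powr_mono[of 1 p 2] by (intro mult_right_mono) auto
  also have "\<dots> = (2 * gn f) powr p" by (simp add: powr_mult)
  finally show "(\<Sum>j<N. norm (q j f) powr p * 1) \<le> (2 * gn f) powr p" .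
qed (auto simp: p)

text \<open>The functionals \<open>q j\<close> are only triangular with respect to \<open>v\<close>: \<open>q j (v k) = 0\<close> for \<open>k > j\<close>.
  Forward substitution makes them biorthogonal to \<open>v\<close>.\<close>

fun coef :: "(nat \<Rightarrow> 'a) \<Rightarrow> nat \<Rightarrow> 'a"
  where "coef f j = q j f - (\<Sum>k<j. q j (v k) * coef f k)"

declare coef.simps [simp del]

lemma coef_add: "coef (f + g) = coef f + coef g"
proof
  show "coef (f + g) j = (coef f + coef g) j" for j
  proof (induction j rule: less_induct)
    case (less j)
    have "(\<Sum>k<j. q j (v k) * coef (f + g) k)
        = (\<Sum>k<j. q j (v k) * coef f k) + (\<Sum>k<j. q j (v k) * coef g k)"
      unfolding sum.distrib[symmetric] distrib_left[symmetric]
      by (intro sum.cong refl) (simp only: less lessThan_iff plus_fun_apply)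
    then have "coef (f + g) j = q j f + q j g
        - ((\<Sum>k<j. q j (v k) * coef f k) + (\<Sum>k<j. q j (v k) * coef g k))"
      by (simp only: coef.simps[of "f + g" j] q_add)
    also have "\<dots> = coef f j + coef g j"
      by (simp only: coef.simps[of f j] coef.simps[of g j] add_diff_add)
    also have "\<dots> = (coef f + coef g) j" by (rule plus_fun_apply[symmetric])
    finally show ?case .
  qed
qed

lemma coef_scale: "coef (seq_scale c f) = seq_scale c (coef f)"
proof
  show "coef (seq_scale c f) j = seq_scale c (coef f) j" for j
  proof (induction j rule: less_induct)
    case (less j)
    have "(\<Sum>k<j. q j (v k) * coef (seq_scale c f) k) = c * (\<Sum>k<j. q j (v k) * coef f k)"
      unfolding sum_distrib_left by (intro sum.cong refl) (simp only: less lessThan_iff, simp add: seq_scale_def)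
    then have "coef (seq_scale c f) j = c * q j f - c * (\<Sum>k<j. q j (v k) * coef f k)"
      by (simp only: coef.simps[of "seq_scale c f" j] q_scale)
    then have "coef (seq_scale c f) j = c * coef f j"
      by (simp add: coef.simps[of f j] right_diff_distrib)
    then show ?case by (simp only: seq_scale_def)
  qed
qed

lemma coef_synth: "coef (synth b) = b"
proof
  show "coef (synth b) j = b j" for j
  proof (induction j rule: less_induct)
    case (less j)
    have "q j (synth b) = q j (\<Sum>k\<le>j. seq_scale (b k) (v k))"
    proof (rule q_cong)
      fix a assume "a \<in> F j"
      then have a: "n j \<le> a" "a < n (Suc j)" using F_sub[of j] by auto
      have "synth b a = (\<Sum>k\<le>j. b k * v k a)" unfolding synth_def
      proof (rule sum.mono_neutral_right)
        show "{..j} \<subseteq> {..a}" using le_n[of j] a by auto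
        show "\<forall>k\<in>{..a} - {..j}. b k * v k a = 0"
        proof
          fix k assume "k \<in> {..a} - {..j}"
          then have "n (Suc j) \<le> n k" by (intro n_le) auto
          then show "b k * v k a = 0" using a v_zero[of a k] by simp
        qed
      qed auto
      then show "synth b a = (\<Sum>k\<le>j. seq_scale (b k) (v k)) a"
        by (simp add: sum_fun_apply seq_scale_def)
    qed
    also have "\<dots> = (\<Sum>k\<le>j. b k * q j (v k))" by (simp add: q_sum q_scale)
    also have "\<dots> = (\<Sum>k<j. b k * q j (v k)) + b j"
      by (simp add: lessThan_Suc_atMost[symmetric] q_self)
    finally show ?case
      using less by (simp add: coef.simps[of "synth b" j] mult.commute)
  qed
qed

text \<open>The entries below the diagonal only see the tails of the \<open>v k\<close>, so the correction terms are at
  most half of \<open>lp_part N (coef f)\<close> and can be absorbed.\<close>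

lemma coef_bound:
  assumes f: "f \<in> X"
  shows "coef f \<in> Lp" "lpn (coef f) \<le> 4 * gn f"
proof -
  have "lp_part N (coef f) \<le> 4 * gn f" for N
  proof -
    let ?t = "\<lambda>k j. if k < j then q j (v k) else 0"
    have one: "\<And>a::nat. (1::real) \<ge> 0" by simp
    let ?s = "\<Sum>k<N. seq_scale (- coef f k) (?t k)"
    have "lp_part N (coef f) \<le> lp_part N ((\<lambda>j. q j f) + ?s)"
    proof (rule wlp_mono[OF p one])
      fix j assume "j \<in> {..<N}"
      then have "(\<Sum>k<N. coef f k * ?t k j) = (\<Sum>k<j. q j (v k) * coef f k)"
        by (intro sum.mono_neutral_cong_right) (auto simp: mult.commute)
      then show "norm (coef f j) \<le> norm (((\<lambda>j. q j f) + ?s) j)"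
        by (simp add: coef.simps[of f j] sum_fun_apply seq_scale_def sum_negf)
    qed
    also have "\<dots> \<le> lp_part N (\<lambda>j. q j f) + lp_part N ?s" by (rule wlp_triangle[OF p one])
    also have "lp_part N ?s \<le> (\<Sum>k<N. lp_part N (seq_scale (- coef f k) (?t k)))" by (rule wlp_sum[OF p one])
    also have "\<dots> \<le> (\<Sum>k<N. lp_part N (coef f) * (2 * ((1/2) ^ k / 8)))"
    proof (rule sum_mono)
      fix k assume k: "k \<in> {..<N}"
      let ?r = "tail_from (n (Suc k)) (v k)"
      have "lp_part N (?t k) \<le> lp_part N (\<lambda>j. q j ?r)"
      proof (rule wlp_mono[OF p one])
        fix j
        have "q j (v k) = q j ?r" if "k < j"
          using F_sub[of j] n_le[of "Suc k" j] that
          by (intro q_cong) (auto simp: tail_from_def subset_iff Suc_le_eq)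
        then show "norm (?t k j) \<le> norm (q j ?r)" by simp
      qed
      also have "\<dots> \<le> 2 * gn ?r" by (rule q_lp_part_le[OF tail_from_X(1)[OF v_X]])
      also have "\<dots> \<le> 2 * ((1/2) ^ k / 8)" using v_tail[of k] by (intro mult_left_mono) auto
      finally show "lp_part N (seq_scale (- coef f k) (?t k)) \<le> lp_part N (coef f) * (2 * ((1/2) ^ k / 8))"
        using k coord_le_lp_part[of k N "coef f"]
        by (simp only: wlp_scale[OF p one] norm_minus_cancel) (intro mult_mono, auto simp: wlp_nonneg)
    qed
    also have "\<dots> = lp_part N (coef f) * ((\<Sum>k<N. (1/2) ^ k) / 4)"
      by (simp add: sum_distrib_left sum_divide_distrib)
    also have "\<dots> \<le> lp_part N (coef f) * (1/2)"
      using sum_half_powers[of N] by (intro mult_left_mono) (auto simp: wlp_nonneg)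
    finally show ?thesis using q_lp_part_le[OF f, of N] by simp
  qed
  then show "coef f \<in> Lp" "lpn (coef f) \<le> 4 * gn f" using lpI[of "4 * gn f" "coef f"] by auto
qed

lemma coef_linear: "linear_map garling_sp (lp_space p) coef"
  unfolding linear_map_def using coef_add coef_scale coef_bound by auto

lemma lpn_le_gn_synth: "b \<in> Lp \<Longrightarrow> lpn b \<le> 4 * gn (synth b)"
  using coef_bound(2)[OF synth_bound(1)] coef_synth by metis

lemmas range_synth_complemented =
  range_complemented[OF synth_linear coef_linear synth_bound(2) _ coef_bound(2) coef_synth, simplified]

end

context garling begin

subsection \<open>Selecting blocks\<close>

lemma norming_set:
  assumes "gn v = 1"
  shows "\<exists>A. finite A \<and> (\<Sum>a\<in>A. norm (v a) powr p * w (rk A a)) \<ge> 3/4"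
proof (rule ccontr)
  assume none: "\<not> ?thesis"
  have "gn v \<le> (3/4) powr (1/p)"
  proof (intro garlingI)
    fix A :: "nat set" assume "finite A"
    then have "\<not> (\<Sum>a\<in>A. norm (v a) powr p * w (rk A a)) \<ge> 3/4" using none by blast
    moreover have "((3/4) powr (1/p)) powr p = (3/4::real)" using p by (intro powr_powr_inverse) auto
    ultimately have "(\<Sum>a\<in>A. norm (v a) powr p * w (rk A a)) \<le> ((3/4) powr (1/p)) powr p"
      by linarith
    then show "sn A v \<le> (3/4) powr (1/p)" by (subst sn_le_iff) auto
  qed simp
  also have "\<dots> < 1" using p powr_less_mono2[of "1/p" "3/4" 1] by simp
  finally show False using assms by simp
qed

text \<open>Successive choice of the blocks. The predicate \<open>B\<close> records where the \<open>k\<close>-th vector comes from. The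
  bound on the index \<open>m k\<close> makes these indices increase when \<open>B n k m v\<close> entails \<open>n \<le> m\<close>.\<close>

lemma block_selection:
  fixes B :: "nat \<Rightarrow> nat \<Rightarrow> nat \<Rightarrow> (nat \<Rightarrow> 'a::{real_normed_field,banach}) \<Rightarrow> bool"
  assumes ex: "\<And>n k. \<exists>m v. B n k m v \<and> v \<in> X \<and> gn v = 1 \<and> (\<forall>i<n. v i = 0) \<and>
      (\<forall>i. real n * norm (v i) powr p \<le> 1/4)"
  obtains n m v F where "block_system w p n v F" "\<And>k. B (n k) k (m k) (v k)" "\<And>k. m k < n (Suc k)"
proof -
  define good where "good n k x \<longleftrightarrow> (case x of (m, v, n', F) \<Rightarrow>
      B n k m v \<and> v \<in> X \<and> gn v = 1 \<and> (\<forall>i<n. v i = 0) \<and> (\<forall>i. real n * norm (v i) powr p \<le> 1/4) \<and>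
      n < n' \<and> m < n' \<and> F \<subseteq> {n..<n'} \<and> (\<Sum>a\<in>F. norm (v a) powr p * w (rk F a)) \<ge> 3/4 \<and>
      gn (tail_from n' v) \<le> (1/2) ^ k / 8)" for n k x
  have "\<exists>x. good n k x" for n k
  proof -
    obtain m v where v: "B n k m v" "v \<in> X" "gn v = 1" "\<forall>i<n. v i = 0"
        "\<forall>i. real n * norm (v i) powr p \<le> 1/4" using ex[of n k] by blast
    obtain A where A: "finite A" "(\<Sum>a\<in>A. norm (v a) powr p * w (rk A a)) \<ge> 3/4"
      using norming_set[OF v(3)] by blast
    let ?F = "A \<inter> {n..}"
    have "(\<Sum>a\<in>A. norm (v a) powr p * w (rk A a)) = (\<Sum>a\<in>?F. norm (v a) powr p * w (rk A a))"
      using v(4) A(1) p by (intro sum.mono_neutral_right) (auto simp: not_le)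
    also have "\<dots> \<le> (\<Sum>a\<in>?F. norm (v a) powr p * w (rk ?F a))"
      by (intro sum_mono mult_left_mono w_antimono rk_mono_set) auto
    finally have F: "(\<Sum>a\<in>?F. norm (v a) powr p * w (rk ?F a)) \<ge> 3/4" using A(2) by simp
    obtain n1 where n1: "\<forall>i\<ge>n1. gn (tail_from i v) \<le> (1/2) ^ k / 8"
      using tail_from_tendsto[OF v(2), of "(1/2) ^ k / 8"] by auto
    obtain n2 where n2: "A \<subseteq> {..<n2}" using A(1) finite_nat_set_iff_bounded by auto
    let ?n = "Suc (n + m + n1 + n2)"
    have "?F \<subseteq> {n..<?n}" using n2 by force
    moreover have "gn (tail_from ?n v) \<le> (1/2) ^ k / 8" using n1 by simp
    ultimately have "good n k (m, v, ?n, ?F)" unfolding good_def using v F by simp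
    then show ?thesis ..
  qed
  then obtain x where x: "\<And>n k. good n k (x n k)" by metis
  define n where "n = rec_nat 0 (\<lambda>k n. fst (snd (snd (x n k))))"
  have nS: "n (Suc k) = fst (snd (snd (x (n k) k)))" for k by (simp add: n_def)
  define m where "m k = fst (x (n k) k)" for k
  define v where "v k = fst (snd (x (n k) k))" for k
  define F where "F k = snd (snd (snd (x (n k) k)))" for k
  have g: "good (n k) k (m k, v k, n (Suc k), F k)" for k
    using x[of "n k" k] by (simp add: nS m_def v_def F_def)
  show thesis
  proof (rule that)
    show "block_system w p n v F"
    proof
      show "strict_mono n" using g by (auto simp: strict_mono_Suc_iff good_def)
    qed (use g in \<open>auto simp: good_def\<close>)
    show "B (n k) k (m k) (v k)" "m k < n (Suc k)" for k using g[of k] by (auto simp: good_def)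
  qed
qed

section \<open>Saturation by complemented copies of \<open>\<ell>\<^sub>p\<close>\<close>

lemma infinite_dimensional_zero_below:
  fixes V :: "(nat \<Rightarrow> 'a::{real_normed_field,banach}) set"
  assumes V: "seq.subspace V" and inf: "infinite_dimensional V"
  shows "infinite_dimensional {f \<in> V. \<forall>i<n. f i = 0}"
proof (induction n)
  case (Suc n)
  let ?V = "{f \<in> V. \<forall>i<n. f i = 0}" and ?W = "{f \<in> V. \<forall>i<Suc n. f i = 0}"
  show ?case
  proof (cases "?V \<subseteq> ?W")
    case True
    then have "?V = ?W" by force
    then show ?thesis using Suc by simp
  next
    case False
    then obtain u where u: "u \<in> V" "\<forall>i<n. u i = 0" "u n \<noteq> 0" by (auto simp: less_Suc_eq)
    show ?thesis
      unfolding infinite_dimensional_def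
    proof
      assume "\<exists>B. finite B \<and> ?W \<subseteq> seq.span B"
      then obtain B where B: "finite B" "?W \<subseteq> seq.span B" by blast
      have "?V \<subseteq> seq.span (insert u B)"
      proof
        fix f assume f: "f \<in> ?V"
        let ?c = "f n / u n"
        let ?g = "f - seq_scale ?c u"
        have "?g \<in> V" using f u V by (intro seq.subspace_diff seq.subspace_scale) auto
        moreover have "?g i = 0" if "i < Suc n" for i
          using that f u by (auto simp: seq_scale_def less_Suc_eq)
        ultimately have "?g \<in> ?W" by blast
        then have "?g \<in> seq.span (insert u B)"
          using B(2) seq.span_mono[of B "insert u B"] by blast
        moreover have "seq_scale ?c u \<in> seq.span (insert u B)"
          by (intro seq.span_scale seq.span_base) simp
        ultimately have "?g + seq_scale ?c u \<in> seq.span (insert u B)" by (rule seq.span_add)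
        then show "f \<in> seq.span (insert u B)" by (simp only: diff_add_cancel)
      qed
      then show False using Suc B(1) unfolding infinite_dimensional_def by (meson finite_insert)
    qed
  qed
qed (use inf in simp)

text \<open>Otherwise the supremum norm and the Garling norm would be equivalent on the vectors of \<open>V\<close> that
  vanish below \<open>n\<close>. Sums of such vectors whose essential parts are far apart remain bounded in the supremum norm,
  but their Garling norms grow like the partial sums of \<open>w\<close>.\<close>

lemma flat_unit_vectors:
  fixes V :: "(nat \<Rightarrow> 'a::{real_normed_field,banach}) set"
  assumes V: "seq.subspace V" "V \<subseteq> X" and inf: "infinite_dimensional V" and e: "e > 0"
  shows "\<exists>v\<in>V. gn v = 1 \<and> (\<forall>i<n. v i = 0) \<and> (\<forall>i. norm (v i) \<le> e)"
proof (rule ccontr)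
  assume none: "\<not> ?thesis"
  have gn_inv: "gn (seq_scale (of_real (1 / gn f)) f) = 1" if "f \<in> X" "f \<noteq> 0" for f :: "nat \<Rightarrow> 'a"
  proof -
    have "gn f \<noteq> 0" using gn_eq_0[OF that(1)] that(2) by blast
    then have pos: "gn f > 0" using gn_nonneg[of f] by linarith
    let ?c = "of_real (1 / gn f) :: 'a"
    have "gn (seq_scale ?c f) \<le> 1" using X_scale(2)[OF that(1), of ?c] pos by (simp add: norm_divide)
    moreover have "seq_scale (of_real (gn f)) (seq_scale ?c f) = f"
      using pos by (auto simp: fun_eq_iff seq_scale_def)
    then have "gn f \<le> gn f * gn (seq_scale ?c f)"
      using X_scale(2)[OF X_scale(1)[OF that(1)], of "of_real (gn f)" ?c] pos by simp
    then have "1 \<le> gn (seq_scale ?c f)" using pos by simp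
    ultimately show ?thesis by simp
  qed
  have peak: "\<exists>i. norm (f i) > e * gn f" if "f \<in> V" "f \<noteq> 0" "\<forall>i<n. f i = 0" for f
  proof -
    let ?g = "seq_scale (of_real (1 / gn f)) f"
    have "gn ?g = 1" using that V by (intro gn_inv) auto
    moreover have "?g \<in> V" using V that by (intro seq.subspace_scale) auto
    moreover have "\<forall>i<n. ?g i = 0" using that by (simp add: seq_scale_def)
    ultimately obtain i where "norm (?g i) > e" using none by (meson not_le)
    moreover have "gn f > 0" using gn_eq_0[of f] that V gn_nonneg[of f] by (metis less_le subsetD)
    ultimately show ?thesis by (intro exI[of _ i]) (simp add: seq_scale_def norm_divide field_simps)
  qed
  have "\<exists>y A. y \<in> V \<and> (\<forall>i<n. y i = 0) \<and> (\<forall>i. norm (y i) \<le> 2) \<and> finite A \<and> card A = N \<and>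
      (\<forall>a\<in>A. norm (y a) \<ge> e/2)" for N
  proof (induction N)
    case 0
    have "0 \<in> V" using V by (simp add: seq.subspace_0)
    then show ?case by (intro exI[of _ "0 :: nat \<Rightarrow> 'a"] exI[of _ "{}"]) (auto simp: zero_fun_def)
  next
    case (Suc N)
    then obtain y A where y: "y \<in> V" "\<forall>i<n. y i = 0" "\<forall>i. norm (y i) \<le> 2" "finite A" "card A = N"
      "\<forall>a\<in>A. norm (y a) \<ge> e/2" by blast
    have "min 1 (e/2) > 0" using e by simp
    then obtain n1 where n1: "\<And>i. i \<ge> n1 \<Longrightarrow> norm (y i) < min 1 (e/2)"
      using X_c0[of y] y(1) V(2) unfolding lim_sequentially dist_norm diff_0_right by blast
    obtain n2 where n2: "A \<subseteq> {..<n2}" using y(4) finite_nat_set_iff_bounded by auto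
    define m where "m = n + n1 + n2"
    have "\<not> {f \<in> V. \<forall>i<m. f i = 0} \<subseteq> {0}"
    proof
      assume "{f \<in> V. \<forall>i<m. f i = 0} \<subseteq> {0}"
      then have "{f \<in> V. \<forall>i<m. f i = 0} \<subseteq> seq.span {}" by (simp only: seq.span_empty)
      then show False
        using infinite_dimensional_zero_below[OF V(1) inf, of m]
        unfolding infinite_dimensional_def by blast
    qed
    then obtain f where f: "f \<in> V" "\<forall>i<m. f i = 0" "f \<noteq> 0" by blast
    let ?u = "seq_scale (of_real (1 / gn f)) f"
    have u1: "gn ?u = 1" using f V by (intro gn_inv) auto
    have uV: "?u \<in> V" using V f by (intro seq.subspace_scale) auto
    have u0: "\<forall>i<m. ?u i = 0" using f by (simp add: seq_scale_def)
    have "?u \<noteq> 0" using u1 by force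
    then obtain t where t: "norm (?u t) > e"
      using peak[OF uV] u0 u1 by (auto simp: m_def)
    have tm: "t \<ge> m"
    proof (rule ccontr)
      assume "\<not> t \<ge> m"
      then have "?u t = 0" using u0 by simp
      then show False using t e by simp
    qed
    define u where "u = ?u"
    note u = u1[folded u_def] uV[folded u_def] u0[folded u_def] t[folded u_def]
    have u_le: "norm (u i) \<le> 1" for i using coord_le_gn[of u i] u V by auto
    let ?y = "y + u" and ?A = "insert t A"
    have tA: "t \<notin> A" using n2 tm by (auto simp: m_def)
    have "?y \<in> V" using V y u by (intro seq.subspace_add) auto
    moreover have "\<forall>i<n. ?y i = 0" using y u by (simp add: m_def)
    moreover have "norm (?y i) \<le> 2" for i
    proof (cases "i < m")
      case True
      then show ?thesis using y(3) u(3) by simp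
    next
      case False
      then have "norm (y i) \<le> 1" using n1[of i] by (simp add: m_def)
      then show ?thesis using u_le[of i] norm_triangle_ineq[of "y i" "u i"] by simp
    qed
    moreover have "finite ?A" "card ?A = Suc N" using y tA by auto
    moreover have "norm (?y a) \<ge> e/2" if "a \<in> ?A" for a
    proof (cases "a = t")
      case True
      have "norm (y t) < e/2" using n1[of t] tm by (simp add: m_def)
      then show ?thesis using True u(4) norm_triangle_ineq4[of "y t + u t" "y t"] by simp
    next
      case False
      then have "a \<in> A" "a < m" using that n2 by (auto simp: m_def)
      then show ?thesis using y(6) u(3) by simp
    qed
    ultimately show ?case by blast
  qed
  moreover obtain N where N: "(\<Sum>j<N. w j) > (2/e) powr p / (e/2) powr p"
    using sum_w_tendsto unfolding filterlim_at_top_dense eventually_sequentially by blast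
  ultimately obtain y A where y: "y \<in> V" "\<forall>i<n. y i = 0" "\<forall>i. norm (y i) \<le> 2" "finite A" "card A = N"
      "\<forall>a\<in>A. norm (y a) \<ge> e/2" by blast
  have "(e/2) powr p * (\<Sum>j<N. w j) \<le> (\<Sum>a\<in>A. norm (y a) powr p * w (rk A a))"
    using power_sum_ge_const[of A "e/2" y] y e by simp
  also have "\<dots> \<le> gn y powr p" using y V by (intro gn_powr_ge) auto
  finally have "(e/2) powr p * (\<Sum>j<N. w j) \<le> gn y powr p" .
  then have "(2/e) powr p < gn y powr p"
    using N e by (simp add: field_simps)
  then have gy: "2/e < gn y" using powr_mono2[of p "gn y" "2/e"] p gn_nonneg[of y] by force
  have "y \<noteq> 0"
  proof
    assume "y = 0"
    then show False using gy e by (simp add: less_divide_eq divide_less_0_iff)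
  qed
  then obtain i where "norm (y i) > e * gn y" using peak y by blast
  moreover have "e * gn y > 2" using gy e by (simp add: field_simps)
  ultimately show False using y(3) by (smt (verit))
qed

theorem garling_saturated:
  "uniformly_complementably_saturated (garling_sp :: 'a::{real_normed_field,banach} seq_space)
     (lp_space p)"
  unfolding uniformly_complementably_saturated_def
proof (intro exI[of _ 8] allI impI)
  fix V :: "(nat \<Rightarrow> 'a) set"
  assume V: "closed_subspace garling_sp V \<and> infinite_dimensional V"
  then have sub: "seq.subspace V" "V \<subseteq> X" unfolding closed_subspace_iff by auto
  have "\<exists>m v. v \<in> V \<and> v \<in> X \<and> gn v = 1 \<and> (\<forall>i<n. v i = 0) \<and> (\<forall>i. real n * norm (v i) powr p \<le> 1/4)"
    for n
  proof -
    define e where "e = (1 / (4 * (real n + 1))) powr (1/p)"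
    have "e > 0" by (simp add: e_def)
    obtain v where v: "v \<in> V" "gn v = 1" "\<forall>i<n. v i = 0" "\<And>i. norm (v i) \<le> e"
      using flat_unit_vectors[OF sub _ \<open>e > 0\<close>, of n] V by blast
    have "real n * norm (v i) powr p \<le> 1/4" for i
    proof -
      have "norm (v i) powr p \<le> e powr p" using v(4) p by (intro powr_mono2) auto
      also have "\<dots> = 1 / (4 * (real n + 1))" unfolding e_def using p by (intro powr_powr_inverse) auto
      finally have "real n * norm (v i) powr p \<le> real n * (1 / (4 * (real n + 1)))"
        by (intro mult_left_mono) auto
      also have "\<dots> \<le> 1/4" by (simp add: field_simps)
      finally show ?thesis .
    qed
    then show ?thesis using v sub by blast
  qed
  then show "\<exists>Z. closed_subspace garling_sp Z \<and> Z \<subseteq> V \<and>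
      subspace_as_space garling_sp Z \<approx> lp_space p \<and> C_complemented 8 garling_sp Z"
  proof (rule block_selection[where B = "\<lambda>n k m v. v \<in> V"])
    fix n m v F assume bs: "block_system w p n v F" and vV: "\<And>k::nat. v k \<in> V"
    interpret b: block_system w p n v F by (rule bs)
    have "b.synth ` Lp \<subseteq> V" using b.synth_in_closed[OF _ vV] V by blast
    moreover have "closed_subspace garling_sp (b.synth ` Lp)"
      using b.range_synth_complemented(1) unfolding C_complemented_def by (rule conjunct1)
    ultimately show "\<exists>Z. closed_subspace garling_sp Z \<and> Z \<subseteq> V \<and>
        subspace_as_space garling_sp Z \<approx> lp_space p \<and> C_complemented 8 garling_sp Z"
      using b.range_synth_complemented by (intro exI[of _ "b.synth ` Lp"] conjI)
  qed
qed

end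

section \<open>Complementable homogeneity\<close>

context garling begin

lemma gn_le_l1:
  assumes "M \<ge> 0" "\<And>N. (\<Sum>i<N. norm (f i)) \<le> M"
  shows "f \<in> X" "gn f \<le> M"
proof -
  have "sn A f \<le> M" if A: "finite A" for A
  proof -
    obtain N where N: "A \<subseteq> {..<N}" using A finite_nat_set_iff_bounded by auto
    have "sn A f \<le> (\<Sum>a\<in>A. norm (f a))" by (rule sn_le_sum[OF A])
    also have "\<dots> \<le> (\<Sum>i<N. norm (f i))" using N by (intro sum_mono2) auto
    also have "\<dots> \<le> M" by (rule assms)
    finally show ?thesis .
  qed
  then show "f \<in> X" "gn f \<le> M" using garlingI[of M f] assms(1) by auto
qed

subsection \<open>Inverting small perturbations of the identity\<close>

text \<open>The series of the powers of \<open>K\<close> is summed pointwise. The Garling norm is a supremum of seminorms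
  depending on finitely many coordinates, so norm bounds for the partial sums pass to the limit, and no
  completeness of the Garling space is needed. The left inverse property holds by telescoping.\<close>

lemma neumann:
  fixes K :: "(nat \<Rightarrow> 'a::{real_normed_field,banach}) \<Rightarrow> nat \<Rightarrow> 'a"
  assumes K: "linear_map garling_sp garling_sp K"
    and small: "\<And>b. b \<in> X \<Longrightarrow> gn (K b) \<le> gn b / 2"
  obtains L where "linear_map garling_sp garling_sp L" "\<And>f. f \<in> X \<Longrightarrow> gn (L f) \<le> 2 * gn f"
    "\<And>b. b \<in> X \<Longrightarrow> L (b - K b) = b"
proof -
  have KX: "K f \<in> X" if "f \<in> X" for f using K that by (auto simp: linear_map_def)
  have Kadd: "K (f + g) = K f + K g" if "f \<in> X" "g \<in> X" for f g
    using K that unfolding linear_map_def by blast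
  have Ksc: "K (seq_scale c f) = seq_scale c (K f)" if "f \<in> X" for c f
    using K that unfolding linear_map_def by blast
  have pow: "(K ^^ n) f \<in> X \<and> gn ((K ^^ n) f) \<le> (1/2) ^ n * gn f" if "f \<in> X" for n f
  proof (induction n)
    case (Suc n)
    then show ?case using KX small[of "(K ^^ n) f"] by simp
  qed (use that in simp)
  have pow_add: "(K ^^ n) (f + g) = (K ^^ n) f + (K ^^ n) g" if "f \<in> X" "g \<in> X" for n f g
  proof (induction n)
    case (Suc n)
    have "(K ^^ Suc n) (f + g) = K ((K ^^ n) (f + g))" by simp
    also have "\<dots> = K ((K ^^ n) f) + K ((K ^^ n) g)"
      unfolding Suc using Kadd pow that by blast
    finally show ?case by (simp only: funpow.simps o_apply)
  qed (simp only: funpow.simps id_apply)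
  have pow_sc: "(K ^^ n) (seq_scale c f) = seq_scale c ((K ^^ n) f)" if "f \<in> X" for n c f
  proof (induction n)
    case (Suc n)
    then show ?case using Ksc pow[OF that, of n] by simp
  qed simp
  have le: "norm ((K ^^ n) f i) \<le> (1/2) ^ n * gn f" if "f \<in> X" for n f i
    using coord_le_gn[of "(K ^^ n) f" i] pow[OF that, of n] by auto
  have summ: "summable (\<lambda>n. (K ^^ n) f i)" if "f \<in> X" for f i
  proof (rule summable_comparison_test)
    show "\<exists>N. \<forall>n\<ge>N. norm ((K ^^ n) f i) \<le> (1/2) ^ n * gn f" using le[OF that] by blast
    show "summable (\<lambda>n. (1/2::real) ^ n * gn f)" by (intro summable_mult2 summable_geometric) simp
  qed
  define L where "L f = (\<lambda>i. \<Sum>n. (K ^^ n) f i)" for f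
  have bound: "L f \<in> X \<and> gn (L f) \<le> 2 * gn f" if f: "f \<in> X" for f
  proof -
    have "sn A (L f) \<le> 2 * gn f" if A: "finite A" for A
    proof -
      let ?s = "\<lambda>N. \<Sum>n<N. (K ^^ n) f"
      have part: "sn A (?s N) \<le> 2 * gn f" for N
      proof -
        have "sn A (?s N) \<le> (\<Sum>n<N. sn A ((K ^^ n) f))" by (rule sn_sum)
        also have "\<dots> \<le> (\<Sum>n<N. (1/2) ^ n * gn f)"
        proof (rule sum_mono)
          fix n
          have "sn A ((K ^^ n) f) \<le> gn ((K ^^ n) f)" using pow[OF f, of n] by (intro sn_le_gn A) auto
          then show "sn A ((K ^^ n) f) \<le> (1/2) ^ n * gn f" using pow[OF f, of n] by linarith
        qed
        also have "\<dots> = (\<Sum>n<N. (1/2) ^ n) * gn f" by (simp add: sum_distrib_right)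
        also have "\<dots> \<le> 2 * gn f" by (intro mult_right_mono sum_half_powers) simp
        finally show ?thesis .
      qed
      have "(\<lambda>N. ?s N a) \<longlonglongrightarrow> L f a" for a
        using summable_LIMSEQ[OF summ[OF f, of a]] by (simp add: L_def sum_fun_apply)
      then have "(\<lambda>N. \<Sum>a\<in>A. norm (?s N a) powr p * w (rk A a))
          \<longlonglongrightarrow> (\<Sum>a\<in>A. norm (L f a) powr p * w (rk A a))"
        using p by (intro tendsto_sum tendsto_mult tendsto_powr' tendsto_norm tendsto_const) auto
      then have "(\<Sum>a\<in>A. norm (L f a) powr p * w (rk A a)) \<le> (2 * gn f) powr p"
        by (rule LIMSEQ_le_const2) (use part in \<open>auto simp: sn_le_iff\<close>)
      then show ?thesis by (subst sn_le_iff) auto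
    qed
    then show ?thesis using garlingI[of "2 * gn f" "L f"] by auto
  qed
  have "L (f + g) = L f + L g" if "f \<in> X" "g \<in> X" for f g
  proof
    fix i
    have "L (f + g) i = (\<Sum>n. (K ^^ n) f i + (K ^^ n) g i)"
      unfolding L_def pow_add[OF that] plus_fun_apply ..
    also have "\<dots> = L f i + L g i"
      unfolding L_def using summ that by (intro suminf_add[symmetric]) auto
    finally show "L (f + g) i = (L f + L g) i" unfolding plus_fun_apply .
  qed
  moreover have "L (seq_scale c f) = seq_scale c (L f)" if "f \<in> X" for c f
    unfolding L_def pow_sc[OF that] using suminf_mult[OF summ[OF that]]
    by (auto simp: seq_scale_def fun_eq_iff)
  ultimately have lin: "linear_map garling_sp garling_sp L"
    unfolding linear_map_def using bound by auto
  have "L (b - K b) = b" if b: "b \<in> X" for b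
  proof
    fix i
    have neg: "b - K b = b + seq_scale (-1) (K b)" by (auto simp: seq_scale_def fun_eq_iff)
    have "(K ^^ n) (b - K b) = (K ^^ n) b + seq_scale (-1) ((K ^^ Suc n) b)" for n
      unfolding neg pow_add[OF b X_scale(1)[OF KX[OF b]]] pow_sc[OF KX[OF b]]
      by (simp only: funpow_Suc_right o_apply)
    then have "(K ^^ n) (b - K b) i = (K ^^ n) b i - (K ^^ Suc n) b i" for n
      by (simp add: seq_scale_def)
    moreover have "(\<lambda>n. (K ^^ n) b i - (K ^^ Suc n) b i) sums ((K ^^ 0) b i - 0)"
      by (intro telescope_sums' summable_LIMSEQ_zero summ b)
    ultimately show "L (b - K b) i = b i" unfolding L_def by (simp add: sums_unique[symmetric])
  qed
  then show thesis using that lin bound by blast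
qed

subsection \<open>Flat vectors and unit vectors\<close>

lemma flat_norm:
  assumes A: "finite A" and f: "\<And>i. norm (f i) \<le> 1" "\<And>i. i \<notin> A \<Longrightarrow> f i = 0"
  shows "f \<in> X" "gn f \<le> (\<Sum>j<card A. w j) powr (1/p)"
proof -
  have nn: "0 \<le> (\<Sum>j<card A. w j)" by (intro sum_nonneg w_nonneg)
  have "sn B f \<le> (\<Sum>j<card A. w j) powr (1/p)" if B: "finite B" for B
  proof (subst sn_le_iff)
    have "(\<Sum>b\<in>B. norm (f b) powr p * w (rk B b)) = (\<Sum>b\<in>A \<inter> B. norm (f b) powr p * w (rk B b))"
      using f p B by (intro sum.mono_neutral_right) auto
    also have "\<dots> \<le> (\<Sum>b\<in>A \<inter> B. 1 * w (rk (A \<inter> B) b))"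
    proof (intro sum_mono mult_mono)
      fix b
      show "norm (f b) powr p \<le> 1" using powr_mono2[of p "norm (f b)" 1] f(1)[of b] p by simp
    qed (auto intro: w_antimono rk_mono_set simp: w_nonneg)
    also have "\<dots> = (\<Sum>j<card (A \<inter> B). w j)" using A by (simp add: sum_rk)
    also have "\<dots> \<le> (\<Sum>j<card A. w j)"
      using A by (intro sum_mono2) (auto simp: w_nonneg card_mono order_less_le_trans)
    also have "\<dots> = ((\<Sum>j<card A. w j) powr (1/p)) powr p"
      by (rule powr_powr_inverse[OF nn p, symmetric])
    finally show "(\<Sum>b\<in>B. norm (f b) powr p * w (rk B b)) \<le> ((\<Sum>j<card A. w j) powr (1/p)) powr p" .
  qed simp
  then show "f \<in> X" "gn f \<le> (\<Sum>j<card A. w j) powr (1/p)"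
    using garlingI[of "(\<Sum>j<card A. w j) powr (1/p)" f] by auto
qed

lemma sum_w_ge_1: "N > 0 \<Longrightarrow> 1 \<le> (\<Sum>j<N. w j)"
  using member_le_sum[of 0 "{..<N}" w] by (simp add: w_nonneg w_zero)

lemma sum_w_small: assumes "e > 0" shows "\<exists>N0. \<forall>N\<ge>N0. (\<Sum>j<N. w j) \<le> e * real N"
proof -
  have "eventually (\<lambda>j. w j < e / 2) sequentially"
    using w_lim assms by (intro order_tendstoD) auto
  then obtain n0 where n0: "\<And>j. j \<ge> n0 \<Longrightarrow> w j < e / 2"
    unfolding eventually_sequentially by blast
  have le: "(\<Sum>j<N. w j) \<le> real n0 + e / 2 * real N" for N
  proof (induction N)
    case (Suc N)
    show ?case
    proof (cases "N < n0")
      case True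
      have "(\<Sum>j<Suc N. w j) \<le> (\<Sum>j<Suc N. 1)" by (intro sum_mono w_le_1)
      also have "\<dots> \<le> real n0 + e / 2 * real (Suc N)" using True assms by (simp add: add_increasing2)
      finally show ?thesis .
    next
      case False
      then show ?thesis using Suc n0[of N] by (simp add: algebra_simps add_divide_distrib)
    qed
  qed (use assms in simp)
  obtain N0 :: nat where N0: "real n0 / (e / 2) \<le> real N0" using real_arch_simple by blast
  have "(\<Sum>j<N. w j) \<le> e * real N" if "N \<ge> N0" for N
  proof -
    have "real n0 / (e / 2) \<le> real N" using N0 that by linarith
    then have "real n0 \<le> e / 2 * real N" using assms by (simp add: field_simps)
    then show ?thesis using le[of N] by linarith
  qed
  then show ?thesis by blast
qed

text \<open>The \<open>m\<close>-th unit vector.\<close>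

definition unit :: "nat \<Rightarrow> nat \<Rightarrow> 'a::{real_normed_field,banach}"
  where "unit m = (\<lambda>i. if i = m then 1 else 0)"

lemma unit_X: "unit m \<in> X" and gn_unit: "gn (unit m) \<ge> 1"
proof -
  show "unit m \<in> X" by (rule flat_norm(1)[of "{m}"]) (auto simp: unit_def)
  then show "gn (unit m) \<ge> 1" using coord_le_gn[of "unit m" m] by (simp add: unit_def)
qed

text \<open>The vector whose entry at \<open>m k\<close> is \<open>b k\<close>, for increasing \<open>m\<close>, and whose other entries are zero.\<close>

definition spread :: "(nat \<Rightarrow> nat) \<Rightarrow> (nat \<Rightarrow> 'a::{real_normed_field,banach}) \<Rightarrow> nat \<Rightarrow> 'a"
  where "spread m b = (\<lambda>i. if i \<in> range m then b (inv m i) else 0)"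

lemma spread_X:
  assumes m: "strict_mono m" and b: "b \<in> X"
  shows "spread m b \<in> X" "gn (spread m b) \<le> gn b"
proof -
  have inj: "inj m" using m by (rule strict_mono_imp_inj_on)
  have "sn A (spread m b) \<le> gn b" if A: "finite A" for A
  proof (subst sn_le_iff)
    have fin: "finite (m -` A)" using A inj by (rule finite_vimageI)
    have "(\<Sum>a\<in>A. norm (spread m b a) powr p * w (rk A a))
        = (\<Sum>a\<in>m ` (m -` A). norm (spread m b a) powr p * w (rk A a))"
      using A p by (intro sum.mono_neutral_right) (auto simp: spread_def)
    also have "\<dots> = (\<Sum>k\<in>m -` A. norm (b k) powr p * w (rk A (m k)))"
      using inj by (subst sum.reindex) (auto simp: spread_def inj_on_def)
    also have "\<dots> \<le> (\<Sum>k\<in>m -` A. norm (b k) powr p * w (rk (m -` A) k))"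
      by (intro sum_mono mult_left_mono w_antimono rk_range m) auto
    also have "\<dots> \<le> gn b powr p" by (rule gn_powr_ge[OF b fin])
    finally show "(\<Sum>a\<in>A. norm (spread m b a) powr p * w (rk A a)) \<le> gn b powr p" .
  qed simp
  then show "spread m b \<in> X" "gn (spread m b) \<le> gn b"
    using garlingI[of "gn b" "spread m b"] by auto
qed

lemma spread_add: "spread m (f + g) = spread m f + spread m g"
  by (auto simp: spread_def fun_eq_iff)

lemma spread_scale: "spread m (seq_scale c f) = seq_scale c (spread m f)"
  by (auto simp: spread_def seq_scale_def fun_eq_iff)

lemma spread_unit: assumes "strict_mono m" shows "spread m (unit k) = unit (m k)"
  using strict_mono_imp_inj_on[OF assms] by (auto simp: spread_def unit_def fun_eq_iff inv_f_f)

lemma subseq_X: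
  assumes t: "strict_mono t" and f: "f \<in> X"
  shows "(\<lambda>k. f (t k)) \<in> X" "gn (\<lambda>k. f (t k)) \<le> gn f"
proof -
  have "sn A (\<lambda>k. f (t k)) \<le> gn f" if A: "finite A" for A
  proof (subst sn_le_iff)
    have "inj_on t A" using t by (intro inj_onI) (simp add: strict_mono_eq)
    then have "(\<Sum>k\<in>A. norm (f (t k)) powr p * w (rk A k))
        = (\<Sum>a\<in>t ` A. norm (f a) powr p * w (rk (t ` A) a))"
      by (simp add: sum.reindex rk_image[OF t])
    also have "\<dots> \<le> gn f powr p" using A by (intro gn_powr_ge f) simp
    finally show "(\<Sum>k\<in>A. norm (f (t k)) powr p * w (rk A k)) \<le> gn f powr p" .
  qed simp
  then show "(\<lambda>k. f (t k)) \<in> X" "gn (\<lambda>k. f (t k)) \<le> gn f"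
    using garlingI[of "gn f" "\<lambda>k. f (t k)"] by auto
qed

end

subsection \<open>Embeddings of the Garling space into itself\<close>

text \<open>An isomorphism \<open>U\<close> of the Garling space onto a subspace, with norm bounds \<open>C\<close> above and \<open>c\<close> below.\<close>

locale garling_embedding = garling w p for w p +
  fixes U :: "(nat \<Rightarrow> 'a::{real_normed_field,banach}) \<Rightarrow> nat \<Rightarrow> 'a" and C c :: real
  assumes U_X: "f \<in> X \<Longrightarrow> U f \<in> X"
    and U_add: "f \<in> X \<Longrightarrow> g \<in> X \<Longrightarrow> U (f + g) = U f + U g"
    and U_scale: "f \<in> X \<Longrightarrow> U (seq_scale d f) = seq_scale d (U f)"
    and C_nonneg: "C \<ge> 0" and U_le: "f \<in> X \<Longrightarrow> gn (U f) \<le> C * gn f"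
    and c_pos: "c > 0" and U_ge: "f \<in> X \<Longrightarrow> c * gn f \<le> gn (U f)"
begin

abbreviation u :: "nat \<Rightarrow> nat \<Rightarrow> 'a" where "u m \<equiv> U (unit m)"

lemma u_X: "u m \<in> X" by (rule U_X[OF unit_X])

lemma U_sum: "(\<And>k. k \<in> I \<Longrightarrow> g k \<in> X) \<Longrightarrow> U (\<Sum>k\<in>I. g k) = (\<Sum>k\<in>I. U (g k))"
proof (induction I rule: infinite_finite_induct)
  case (insert x I)
  have "U (\<Sum>k\<in>insert x I. g k) = U (g x + sum g I)" using insert.hyps by simp
  also have "\<dots> = U (g x) + U (sum g I)" using insert.prems by (intro U_add X_sum) auto
  also have "\<dots> = U (g x) + (\<Sum>k\<in>I. U (g k))" using insert by simp
  also have "\<dots> = (\<Sum>k\<in>insert x I. U (g k))" using insert.hyps by simp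
  finally show ?case .
qed (use U_scale[OF X_0(1), of 0] in \<open>simp_all add: seq_scale_def zero_fun_def\<close>)

text \<open>The unit vectors are weakly null: signed sums of \<open>N\<close> of them have norm \<open>o(N)\<close>.\<close>

lemma u_coord_null:
  assumes e: "e > 0"
  shows "\<exists>m0. \<forall>m\<ge>m0. norm (u m t) \<le> e"
proof (rule ccontr)
  assume "\<not> ?thesis"
  then have inf: "infinite {m. norm (u m t) > e}"
    unfolding infinite_nat_iff_unbounded_le by (auto simp: not_le)
  have "e / (2 * (C + 1)) > 0" using e C_nonneg by simp
  then obtain N0 where N0: "\<And>N. N \<ge> N0 \<Longrightarrow> (\<Sum>j<N. w j) \<le> e / (2 * (C + 1)) * real N"
    using sum_w_small by blast
  define N where "N = Suc N0"
  obtain A where A: "finite A" "card A = N" "A \<subseteq> {m. norm (u m t) > e}"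
    using infinite_arbitrarily_large[OF inf] by blast
  \<comment> \<open>signs that make the \<open>t\<close>-th coordinates of the summands positive\<close>
  define \<sigma> where "\<sigma> k = of_real (norm (u k t)) / u k t" for k
  define f where "f = (\<lambda>i. if i \<in> A then \<sigma> i else 0)"
  have f1: "norm (f i) \<le> 1" for i by (auto simp: f_def \<sigma>_def norm_divide)
  have f0: "f i = 0" if "i \<notin> A" for i using that by (simp add: f_def)
  have f: "f \<in> X" "gn f \<le> (\<Sum>j<N. w j)"
  proof -
    show "f \<in> X" by (rule flat_norm(1)[OF A(1) f1 f0])
    have "gn f \<le> (\<Sum>j<card A. w j) powr (1/p)" by (rule flat_norm(2)[OF A(1) f1 f0])
    also have "\<dots> \<le> (\<Sum>j<N. w j)"
      unfolding A(2) by (intro powr_le_one_over sum_w_ge_1 p) (simp add: N_def)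
    finally show "gn f \<le> (\<Sum>j<N. w j)" .
  qed
  have "f = (\<Sum>k\<in>A. seq_scale (\<sigma> k) (unit k))"
    using A(1) by (auto simp: fun_eq_iff sum_fun_apply seq_scale_def unit_def f_def
        if_distrib[of "\<lambda>x. _ * x"] cong: if_cong)
  then have "U f = (\<Sum>k\<in>A. seq_scale (\<sigma> k) (u k))"
    using U_sum[of A "\<lambda>k. seq_scale (\<sigma> k) (unit k)"] by (simp only: X_scale(1) unit_X U_scale simp_thms)
  then have "U f t = (\<Sum>k\<in>A. \<sigma> k * u k t)" by (simp only: sum_fun_apply seq_scale_def)
  also have "\<dots> = (\<Sum>k\<in>A. of_real (norm (u k t)))"
    using A(3) e by (intro sum.cong refl) (auto simp: \<sigma>_def)
  also have "\<dots> = of_real (\<Sum>k\<in>A. norm (u k t))" by simp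
  finally have "norm (U f t) = (\<Sum>k\<in>A. norm (u k t))" by (simp only: norm_of_real) (simp add: sum_nonneg)
  also have "\<dots> \<ge> (\<Sum>k\<in>A. e)" using A(3) by (intro sum_mono) auto
  finally have "real N * e \<le> norm (U f t)" using A(2) by simp
  also have "\<dots> \<le> gn (U f)" by (rule coord_le_gn[OF U_X[OF f(1)]])
  also have "\<dots> \<le> C * gn f" by (rule U_le[OF f(1)])
  also have "\<dots> \<le> C * (e / (2 * (C + 1)) * real N)"
    using f(2) N0[of N] C_nonneg by (intro mult_left_mono) (auto simp: N_def)
  also have "\<dots> = (C / (C + 1)) * (e * real N / 2)"
    using C_nonneg by (simp add: field_simps)
  also have "\<dots> \<le> 1 * (e * real N / 2)"
    using C_nonneg e by (intro mult_right_mono) auto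
  finally show False using e by (simp add: N_def)
qed

text \<open>If \<open>u m\<close> tended to zero in the supremum norm, then a subsequence would be close to
  multiples of a block system, hence have a lower \<open>\<ell>\<^sub>p\<close>-estimate, whereas sums of \<open>N\<close> unit vectors have norm
  \<open>o(N\<^sup>1\<^sup>/\<^sup>p)\<close>.\<close>

lemma u_not_flat: "\<exists>\<delta>>0. \<forall>M. \<exists>m\<ge>M. \<exists>t. norm (u m t) \<ge> \<delta>"
proof (rule ccontr)
  assume "\<not> ?thesis"
  then have flat: "\<exists>M. \<forall>m\<ge>M. \<forall>t. norm (u m t) < \<delta>" if "\<delta> > 0" for \<delta>
    using that by (meson not_le)
  let ?B = "\<lambda>n k m v. n \<le> m \<and> (\<exists>l\<ge>c/2. gn (u m - seq_scale (of_real l) v) \<le> (1/2) ^ k)"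
  have "\<exists>m v. ?B n k m v \<and> v \<in> X \<and> gn v = 1 \<and> (\<forall>i<n. v i = 0) \<and>
      (\<forall>i. real n * norm (v i) powr p \<le> 1/4)" for n k
  proof -
    \<comment> \<open>the head of \<open>u m\<close> then has norm at most \<open>min (c / 8) ((1/2) ^ k)\<close>, and the entries of the
      normalised tail are at most \<open>2 * \<delta> / c \<le> 1 / (4 * (n + 1))\<close>\<close>
    define \<delta> where "\<delta> = min (c / (8 * (real n + 1))) ((1/2) ^ k / (real n + 1))"
    have \<delta>: "\<delta> > 0" using c_pos by (simp add: \<delta>_def)
    obtain M where M: "\<And>m t. m \<ge> M \<Longrightarrow> norm (u m t) < \<delta>" using flat[OF \<delta>] by blast
    define m where "m = M + n"
    have um: "norm (u m t) \<le> \<delta>" for t using M[of m t] by (simp add: m_def)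
    let ?g = "tail_from n (u m)"
    have gX: "?g \<in> X" by (rule tail_from_X[OF u_X])
    have h: "u m - ?g \<in> X" "gn (u m - ?g) \<le> real n * \<delta>"
    proof -
      have "(\<Sum>i<N. norm ((u m - ?g) i)) \<le> real n * \<delta>" for N
      proof -
        have "(\<Sum>i<N. norm ((u m - ?g) i)) \<le> (\<Sum>i<N. if i < n then \<delta> else 0)"
          using um by (intro sum_mono) (auto simp: tail_from_def)
        also have "\<dots> = (\<Sum>i\<in>{..<N} \<inter> {..<n}. \<delta>)"
          by (intro sum.mono_neutral_cong_right) auto
        also have "\<dots> \<le> (\<Sum>i<n. \<delta>)" using \<delta> by (intro sum_mono2) auto
        finally show ?thesis by simp
      qed
      then show "u m - ?g \<in> X" "gn (u m - ?g) \<le> real n * \<delta>"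
        using gn_le_l1[of "real n * \<delta>" "u m - ?g"] \<delta> by auto
    qed
    have nd1: "real n * \<delta> \<le> c / 8"
    proof -
      have "real n * \<delta> \<le> real n * (c / (8 * (real n + 1)))" by (intro mult_left_mono) (auto simp: \<delta>_def)
      also have "\<dots> \<le> c / 8" using c_pos by (simp add: field_simps)
      finally show ?thesis .
    qed
    have nd2: "real n * \<delta> \<le> (1/2) ^ k"
    proof -
      have "real n * \<delta> \<le> real n * ((1/2) ^ k / (real n + 1))" by (intro mult_left_mono) (auto simp: \<delta>_def)
      also have "\<dots> = real n / (real n + 1) * (1/2) ^ k" by simp
      also have "\<dots> \<le> 1 * (1/2) ^ k" by (intro mult_right_mono) auto
      finally show ?thesis by simp
    qed
    define l where "l = gn ?g"
    have "c * 1 \<le> c * gn (unit m :: nat \<Rightarrow> 'a)" using c_pos gn_unit by (intro mult_left_mono) auto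
    also have "\<dots> \<le> gn (u m)" by (rule U_ge[OF unit_X])
    also have "u m = (u m - ?g) + ?g" by simp
    also have "gn \<dots> \<le> gn (u m - ?g) + gn ?g" by (rule X_add(2)[OF h(1) gX])
    finally have l: "l \<ge> c / 2" using h(2) nd1 c_pos unfolding l_def by linarith
    then have l0: "l > 0" using c_pos by simp
    define v where "v = seq_scale (of_real (1 / l)) ?g"
    have lv: "seq_scale (of_real l) v = ?g" using l0 by (auto simp: v_def seq_scale_def fun_eq_iff)
    have vX: "v \<in> X" unfolding v_def by (rule X_scale(1)[OF gX])
    have "gn v \<le> 1" using X_scale(2)[OF gX, of "of_real (1 / l)"] l0 by (simp add: v_def l_def norm_divide)
    moreover have "gn v \<ge> 1" using X_scale(2)[OF vX, of "of_real l"] l0 by (simp add: lv l_def[symmetric])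
    moreover have "v i = 0" if "i < n" for i using that by (simp add: v_def seq_scale_def tail_from_def)
    moreover have "real n * norm (v i) powr p \<le> 1/4" for i
    proof -
      have "norm (v i) \<le> \<delta> / l"
        using um[of i] l0 \<delta> by (simp add: v_def seq_scale_def tail_from_def norm_divide divide_right_mono)
      also have "\<dots> \<le> (c / (8 * (real n + 1))) / (c / 2)"
        using l l0 \<delta> c_pos by (intro frac_le) (auto simp: \<delta>_def)
      also have "\<dots> = 1 / (4 * (real n + 1))"
      proof -
        have "(c / (8 * x)) / (c / 2) = 1 / (4 * x)" if "x > 0" for x
          using that c_pos by (simp add: field_simps)
        from this[of "real n + 1"] show ?thesis by linarith
      qed
      finally have vi: "norm (v i) \<le> 1 / (4 * (real n + 1))" .
      also have "\<dots> \<le> 1" by (simp add: field_simps)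
      finally have "norm (v i) powr p \<le> norm (v i)" using powr_mono'[of 1 p "norm (v i)"] p by simp
      then have "real n * norm (v i) powr p \<le> real n * (1 / (4 * (real n + 1)))"
        using vi by (intro mult_left_mono) auto
      also have "\<dots> \<le> 1/4" by (simp add: field_simps)
      finally show ?thesis .
    qed
    moreover have "gn (u m - seq_scale (of_real l) v) \<le> (1/2) ^ k" unfolding lv using h(2) nd2 by simp
    ultimately show ?thesis using vX l by (intro exI[of _ m] exI[of _ v]) (auto simp: m_def)
  qed
  then show False
  proof (rule block_selection[where B = ?B])
    fix n m v F
    assume bs: "block_system w p n v F" and B: "\<And>k. ?B (n k) k (m k) (v k)"
      and mn: "\<And>k. m k < n (Suc k)"
    interpret b: block_system w p n v F by (rule bs)
    have "strict_mono m" unfolding strict_mono_Suc_iff using mn B by (meson less_le_trans)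
    then have inj: "inj m" by (rule strict_mono_imp_inj_on)
    obtain l where l: "\<And>k. l k \<ge> c / 2" "\<And>k. gn (u (m k) - seq_scale (of_real (l k)) (v k)) \<le> (1/2) ^ k"
      using B by metis
    have key: "real N * (c / (8 * (C + 2))) powr p \<le> (\<Sum>j<N. w j)" if N: "N > 0" for N
    proof -
      let ?W = "(\<Sum>j<N. w j) powr (1/p)"
      have W1: "?W \<ge> 1" using powr_mono2[of "1/p" 1 "\<Sum>j<N. w j"] sum_w_ge_1[OF N] p by simp
      define a where "a = (\<lambda>k. if k < N then of_real (l k) else (0::'a))"
      have syn: "b.synth a = (\<Sum>k<N. seq_scale (of_real (l k)) (v k))"
        unfolding a_def by (rule b.synth_finite)
      have a_le: "lp_part M a \<le> lp_part N a" for M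
      proof -
        have "(\<Sum>k<M. norm (a k) powr p * 1) \<le> (\<Sum>k<N. norm (a k) powr p * 1)"
        proof -
          have "(\<Sum>k<M. norm (a k) powr p * 1) = (\<Sum>k\<in>{..<M} \<inter> {..<N}. norm (a k) powr p * 1)"
            using p by (intro sum.mono_neutral_right) (auto simp: a_def)
          also have "\<dots> \<le> (\<Sum>k<N. norm (a k) powr p * 1)" by (intro sum_mono2) auto
          finally show ?thesis .
        qed
        then show ?thesis unfolding wlp_def using p by (intro powr_mono2) (auto intro: sum_nonneg)
      qed
      then have aL: "a \<in> Lp" using lpI[of "lp_part N a" a] by (simp add: wlp_nonneg)
      let ?x = "\<lambda>i. if i \<in> m ` {..<N} then 1 else (0::'a)"
      have x: "?x \<in> X" "gn ?x \<le> ?W"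
      proof -
        have "inj_on m {..<N}" using inj by (rule inj_on_subset) simp
        then have "card (m ` {..<N}) = N" by (simp add: card_image)
        then show "?x \<in> X" "gn ?x \<le> ?W" using flat_norm[of "m ` {..<N}" ?x] by auto
      qed
      have "?x = (\<Sum>k<N. unit (m k))"
      proof
        fix i
        have "(\<Sum>k<N. unit (m k) i :: 'a) = (\<Sum>j\<in>m ` {..<N}. unit j i)"
          using inj by (subst sum.reindex) (auto intro: inj_on_subset)
        then show "?x i = (\<Sum>k<N. unit (m k)) i" by (simp add: sum_fun_apply unit_def)
      qed
      then have "U ?x = U (\<Sum>k<N. unit (m k))" by (rule arg_cong)
      also have "\<dots> = (\<Sum>k<N. u (m k))" by (rule U_sum) (rule unit_X)
      finally have Ux: "U ?x = (\<Sum>k<N. u (m k))" .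
      let ?d = "\<Sum>k<N. u (m k) - seq_scale (of_real (l k)) (v k)"
      have dX: "u (m k) - seq_scale (of_real (l k)) (v k) \<in> X" for k
        by (intro X_diff(1) X_scale(1) u_X b.v_X)
      have "gn ?d \<le> (\<Sum>k<N. gn (u (m k) - seq_scale (of_real (l k)) (v k)))"
        by (rule gn_sum) (rule dX)
      also have "\<dots> \<le> (\<Sum>k<N. (1/2) ^ k)" by (intro sum_mono l(2))
      finally have d: "gn ?d \<le> 2" using sum_half_powers[of N] by linarith
      have eq: "b.synth a = U ?x - ?d" unfolding syn Ux by (simp add: sum_subtractf)
      have "gn (b.synth a) \<le> gn (U ?x) + gn ?d"
        unfolding eq by (intro X_diff(2) U_X x(1) X_sum dX)
      also have "\<dots> \<le> C * ?W + 2 * ?W"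
        using U_le[OF x(1)] mult_left_mono[OF x(2) C_nonneg] d W1 by linarith
      finally have syn_le: "gn (b.synth a) \<le> (C + 2) * ?W" by (simp add: distrib_right)
      have "real N * (c / 2) powr p = (\<Sum>k<N. (c / 2) powr p * 1)" by simp
      also have "\<dots> \<le> (\<Sum>k<N. norm (a k) powr p * 1)"
      proof (intro sum_mono mult_right_mono powr_mono2)
        fix k assume "k \<in> {..<N}"
        then show "c / 2 \<le> norm (a k)" using l(1)[of k] by (simp add: a_def)
      qed (use p c_pos in auto)
      also have "\<dots> = lp_part N a powr p" using p by (subst wlp_powr) auto
      also have "\<dots> \<le> (4 * ((C + 2) * ?W)) powr p"
        using lp_part_le_lpn[OF aL, of N] b.lpn_le_gn_synth[OF aL] syn_le p
        by (intro powr_mono2) (auto simp: wlp_nonneg)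
      also have "\<dots> = (4 * (C + 2)) powr p * (\<Sum>j<N. w j)"
      proof -
        have "4 * ((C + 2) * ?W) = (4 * (C + 2)) * ?W" by simp
        then have "(4 * ((C + 2) * ?W)) powr p = ((4 * (C + 2)) * ?W) powr p" by (rule arg_cong)
        also have "\<dots> = (4 * (C + 2)) powr p * (?W powr p)"
          by (rule powr_mult)
        also have "?W powr p = (\<Sum>j<N. w j)"
          by (intro powr_powr_inverse sum_nonneg w_nonneg p)
        finally show ?thesis .
      qed
      finally have "real N * (c / 2) powr p \<le> (4 * (C + 2)) powr p * (\<Sum>j<N. w j)" .
      moreover have "(c / (8 * (C + 2))) powr p = (c / 2) powr p / (4 * (C + 2)) powr p"
      proof -
        have "c / (8 * (C + 2)) = (c / 2) / (4 * (C + 2))" by simp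
        then show ?thesis by (simp only: powr_divide)
      qed
      moreover have "(4 * (C + 2)) powr p > 0" using C_nonneg by simp
      moreover have "r * e \<le> W" if "r * a \<le> x * W" "e = a / x" "x > 0" for r a x W e :: real
        unfolding that(2) using that(1,3) by (simp add: field_simps)
      ultimately show ?thesis by blast
    qed
    let ?e = "(c / (8 * (C + 2))) powr p"
    have e: "?e > 0" using c_pos C_nonneg by simp
    then obtain N0 where N0: "\<And>N. N \<ge> N0 \<Longrightarrow> (\<Sum>j<N. w j) \<le> ?e / 2 * real N"
      using sum_w_small[of "?e / 2"] by auto
    then have "real (Suc N0) * ?e \<le> ?e / 2 * real (Suc N0)" using key[of "Suc N0"] N0[of "Suc N0"] by linarith
    then show False using e by (simp add: mult.commute)
  qed
qed

end

context garling_embedding begin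

subsection \<open>A complemented copy inside the range of an embedding\<close>

text \<open>The pair \<open>(m k, t k)\<close> is chosen from its predecessor alone: \<open>t k\<close> lies so far to the right that all
  \<open>u j\<close> with \<open>j \<le> m (k - 1)\<close> are tiny from there on, and \<open>m k\<close> is so large that all \<open>u j\<close> with \<open>j \<ge> m k\<close>
  are tiny up to \<open>t (k - 1)\<close>.\<close>

lemma almost_diagonal:
  obtains m t \<delta> where "strict_mono m" "strict_mono t" "\<delta> > 0"
    "\<And>k. norm (u (m k) (t k)) \<ge> \<delta>"
    "\<And>j k. j \<noteq> k \<Longrightarrow> norm (u (m j) (t k)) \<le> \<delta> / 8 * ((1/2) ^ j * (1/2) ^ k)"
proof -
  obtain \<delta> where \<delta>: "\<delta> > 0" "\<And>M. \<exists>m\<ge>M. \<exists>t. norm (u m t) \<ge> \<delta>" using u_not_flat by blast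
  define \<eta> where "\<eta> k = \<delta> / 8 * (1/4) ^ Suc k" for k
  have \<eta>: "\<eta> k > 0" for k using \<delta> by (simp add: \<eta>_def)
  define P where "P x \<longleftrightarrow> norm (u (fst x) (snd x)) \<ge> \<delta>" for x :: "nat \<times> nat"
  define Q where "Q k x y \<longleftrightarrow> fst x < fst y \<and> snd x < snd y \<and>
      (\<forall>j\<le>fst x. \<forall>i\<ge>snd y. norm (u j i) \<le> \<eta> k) \<and>
      (\<forall>j\<ge>fst y. \<forall>i\<le>snd x. norm (u j i) \<le> \<eta> k)" for k and x y :: "nat \<times> nat"
  have "\<exists>y. P y \<and> Q k x y" for k x
  proof -
    obtain m t where x: "x = (m, t)" by (cases x)
    have "\<exists>T. \<forall>i\<ge>T. norm (u j i) \<le> \<eta> k" for j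
      using X_c0[OF u_X[of j]] \<eta>[of k] unfolding lim_sequentially dist_norm diff_0_right
      by (meson less_imp_le)
    then obtain T where T: "\<And>j i. i \<ge> T j \<Longrightarrow> norm (u j i) \<le> \<eta> k" by metis
    define T0 where "T0 = Suc t + (\<Sum>j\<le>m. T j)"
    have "min (\<eta> k) (\<delta> / 2) > 0" using \<eta> \<delta> by simp
    then obtain M where M: "\<And>i j. j \<ge> M i \<Longrightarrow> norm (u j i) \<le> min (\<eta> k) (\<delta> / 2)"
      using u_coord_null by metis
    define M0 where "M0 = Suc m + (\<Sum>i\<le>T0. M i)"
    have M0: "norm (u j i) \<le> min (\<eta> k) (\<delta> / 2)" if "j \<ge> M0" "i \<le> T0" for i j
    proof -
      have "M i \<le> (\<Sum>i\<le>T0. M i)" using that by (intro member_le_sum) auto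
      then show ?thesis using that by (intro M) (simp add: M0_def)
    qed
    obtain m' t' where m': "m' \<ge> M0" "norm (u m' t') \<ge> \<delta>" using \<delta>(2) by blast
    \<comment> \<open>up to \<open>T0\<close> the entries of \<open>u m'\<close> are below \<open>\<delta> / 2\<close>, so the large entry lies beyond\<close>
    have t': "t' > T0"
    proof (rule ccontr)
      assume "\<not> t' > T0"
      then show False using M0[OF m'(1), of t'] m'(2) \<delta>(1) by simp
    qed
    have "norm (u j i) \<le> \<eta> k" if "j \<le> m" "i \<ge> t'" for i j
    proof -
      have "T j \<le> (\<Sum>j\<le>m. T j)" using that by (intro member_le_sum) auto
      then show ?thesis using that t' by (intro T) (simp add: T0_def)
    qed
    moreover have "norm (u j i) \<le> \<eta> k" if "j \<ge> m'" "i \<le> t" for i j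
      using M0[of j i] that m' by (simp add: T0_def)
    ultimately have "P (m', t') \<and> Q k x (m', t')"
      unfolding P_def Q_def x using m' t' by (simp add: M0_def T0_def)
    then show ?thesis ..
  qed
  moreover have "\<exists>x. P x" using \<delta>(2)[of 0] by (auto simp: P_def)
  ultimately obtain x where x: "\<And>k. P (x k) \<and> Q k (x k) (x (Suc k))"
    using dependent_nat_choice[of "\<lambda>_. P" Q] by blast
  define m where "m k = fst (x k)" for k
  define t where "t k = snd (x k)" for k
  have mono: "strict_mono m" "strict_mono t"
    using x by (auto simp: strict_mono_Suc_iff m_def t_def Q_def)
  have off: "norm (u (m j) (t k)) \<le> \<delta> / 8 * ((1/2) ^ j * (1/2) ^ k)" if "j \<noteq> k" for j k
  proof -
    have quarter: "\<eta> l \<le> \<delta> / 8 * ((1/2) ^ i * (1/2) ^ Suc l)" if "i \<le> Suc l" for i l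
    proof -
      have "(1/4::real) ^ Suc l = (1/2) ^ Suc l * (1/2) ^ Suc l"
        by (simp add: power_mult_distrib[symmetric])
      also have "\<dots> \<le> (1/2) ^ i * (1/2) ^ Suc l"
        using that by (intro mult_right_mono power_decreasing) auto
      finally show ?thesis unfolding \<eta>_def using \<delta>(1) by (intro mult_left_mono) auto
    qed
    show ?thesis
    proof (cases "j < k")
      case True
      then obtain l where l: "k = Suc l" "j \<le> l" by (cases k) auto
      have "m j \<le> m l" using mono(1) l(2) by (simp add: strict_mono_less_eq)
      then have "norm (u (m j) (t k)) \<le> \<eta> l" using x[of l] by (simp add: Q_def m_def t_def l)
      also have "\<dots> \<le> \<delta> / 8 * ((1/2) ^ j * (1/2) ^ k)" using quarter[of j l] l by simp
      finally show ?thesis .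
    next
      case False
      then have "k < j" using that by simp
      then obtain l where l: "j = Suc l" "k \<le> l" by (cases j) auto
      have "t k \<le> t l" using mono(2) l(2) by (simp add: strict_mono_less_eq)
      then have "norm (u (m j) (t k)) \<le> \<eta> l" using x[of l] by (simp add: Q_def m_def t_def l)
      also have "\<dots> \<le> \<delta> / 8 * ((1/2) ^ j * (1/2) ^ k)" using quarter[of k l] l by (simp add: mult_ac)
      finally show ?thesis .
    qed
  qed
  have diag: "norm (u (m k) (t k)) \<ge> \<delta>" for k using x[of k] by (simp add: P_def m_def t_def)
  show thesis by (rule that[OF mono \<delta>(1) diag off])
qed

text \<open>On vectors spread along \<open>m\<close>, applying \<open>U\<close>, evaluating at the points \<open>t k\<close> and dividing by the
  diagonal entries is a small perturbation of the identity.\<close>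

lemma complemented_copy:
  obtains Z where "Z \<subseteq> U ` X" "complemented garling_sp Z" "subspace_as_space garling_sp Z \<approx> garling_sp"
proof -
  obtain m t \<delta> where mono: "strict_mono m" "strict_mono t" and \<delta>: "\<delta> > 0"
    and diag: "\<And>k. norm (u (m k) (t k)) \<ge> \<delta>"
    and off: "\<And>j k. j \<noteq> k \<Longrightarrow> norm (u (m j) (t k)) \<le> \<delta> / 8 * ((1/2) ^ j * (1/2) ^ k)"
    by (rule almost_diagonal) (rule that)
  define S where "S b = U (spread m b)" for b
  define E where "E f = (\<lambda>k. f (t k) / u (m k) (t k))" for f :: "nat \<Rightarrow> 'a"
  have S_X: "S b \<in> X" if "b \<in> X" for b unfolding S_def by (intro U_X spread_X mono that)
  have S_add: "S (f + g) = S f + S g" if "f \<in> X" "g \<in> X" for f g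
    unfolding S_def spread_add by (intro U_add spread_X mono that)
  have S_scale: "S (seq_scale d f) = seq_scale d (S f)" if "f \<in> X" for d f
    unfolding S_def spread_scale by (intro U_scale spread_X mono that)
  have S_le: "gn (S b) \<le> C * gn b" if "b \<in> X" for b
    using U_le[OF spread_X(1)[OF mono(1) that]] mult_left_mono[OF spread_X(2)[OF mono(1) that] C_nonneg]
    unfolding S_def by linarith
  have S_unit: "S (unit k) = u (m k)" for k unfolding S_def spread_unit[OF mono(1)] ..
  have E_X: "E f \<in> X \<and> gn (E f) \<le> (1 / \<delta>) * gn f" if f: "f \<in> X" for f
  proof -
    let ?h = "seq_scale (of_real (1 / \<delta>)) (\<lambda>k. f (t k))"
    have h: "?h \<in> X" "gn ?h \<le> (1 / \<delta>) * gn (\<lambda>k. f (t k))"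
      using X_scale[OF subseq_X(1)[OF mono(2) f], of "of_real (1 / \<delta>)"] \<delta> by (auto simp: norm_divide)
    have "norm (E f k) \<le> norm (?h k)" for k
      using diag[of k] \<delta> by (simp add: E_def seq_scale_def norm_mult norm_divide frac_le)
    then have "E f \<in> X" "gn (E f) \<le> gn ?h" using X_mono[OF h(1), of "E f"] by auto
    moreover have "(1 / \<delta>) * gn (\<lambda>k. f (t k)) \<le> (1 / \<delta>) * gn f"
      using subseq_X(2)[OF mono(2) f] \<delta> by (intro mult_left_mono) auto
    ultimately show ?thesis using h by linarith
  qed
  have E_add: "E (f + g) = E f + E g" for f g by (auto simp: E_def add_divide_distrib)
  have E_scale: "E (seq_scale d f) = seq_scale d (E f)" for d f by (auto simp: E_def seq_scale_def)
  define K where "K b = b - E (S b)" for b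
  have K_coord: "norm (K b k) \<le> gn b / 4 * (1/2) ^ k" if b: "b \<in> X" for b k
  proof (rule field_le_epsilon)
    fix e :: real assume e: "e > 0"
    have "e * \<delta> / (C + 1) > 0" using e \<delta> C_nonneg by simp
    from tail_from_tendsto[OF b this] obtain n0 where n0: "\<And>n. n \<ge> n0 \<Longrightarrow> gn (tail_from n b) \<le> e * \<delta> / (C + 1)"
      by blast
    define N where "N = n0 + k + 1"
    let ?h = "\<Sum>j<N. seq_scale (b j) (unit j)"
    let ?r = "tail_from N b"
    have hX: "?h \<in> X" by (intro X_sum X_scale unit_X)
    have rX: "?r \<in> X" by (rule tail_from_X[OF b])
    have split: "b = ?h + ?r"
    proof
      fix i
      have "?h i = (if i < N then b i else 0)"
        by (simp add: sum_fun_apply seq_scale_def unit_def if_distrib[of "\<lambda>x. _ * x"] cong: if_cong)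
      then show "b i = (?h + ?r) i" by (simp add: tail_from_def)
    qed
    have Sh: "S ?h i = (\<Sum>j<N. b j * u (m j) i)" for i
    proof -
      have "S (\<Sum>j<n. seq_scale (b j) (unit j)) i = (\<Sum>j<n. b j * u (m j) i)" for n
      proof (induction n)
        case 0
        have "S 0 = 0" using S_scale[OF X_0(1), of 0] by (simp add: seq_scale_def zero_fun_def)
        then have zero: "S (\<Sum>j<0. seq_scale (b j) (unit j)) = 0" unfolding lessThan_0 sum.empty .
        show ?case unfolding zero by simp
      next
        case (Suc n)
        have "S (\<Sum>j<Suc n. seq_scale (b j) (unit j))
            = S ((\<Sum>j<n. seq_scale (b j) (unit j)) + seq_scale (b n) (unit n))" by simp
        also have "\<dots> = S (\<Sum>j<n. seq_scale (b j) (unit j)) + seq_scale (b n) (u (m n))"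
          by (subst S_add) (auto intro!: X_sum X_scale unit_X simp only: S_scale unit_X S_unit)
        finally have step: "S (\<Sum>j<Suc n. seq_scale (b j) (unit j))
            = S (\<Sum>j<n. seq_scale (b j) (unit j)) + seq_scale (b n) (u (m n))" .
        show ?case unfolding step plus_fun_apply Suc by (simp add: seq_scale_def)
      qed
      then show ?thesis .
    qed
    have "S b = S (?h + ?r)" using split by (rule arg_cong)
    also have "\<dots> = S ?h + S ?r" by (rule S_add[OF hX rX])
    finally have Sb: "S b = S ?h + S ?r" .
    let ?d = "u (m k) (t k)"
    have d: "norm ?d > 0" "?d \<noteq> 0" using diag[of k] \<delta> by auto
    let ?s = "\<Sum>j\<in>{..<N} - {k}. b j * u (m j) (t k)"
    have "S b (t k) = b k * ?d + ?s + S ?r (t k)"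
      unfolding Sb plus_fun_apply Sh using sum.remove[of "{..<N}" k] by (simp add: N_def)
    then have "K b k = - (?s + S ?r (t k)) / ?d"
      using d(2) by (simp add: K_def E_def field_simps)
    then have "norm (K b k) = norm (?s + S ?r (t k)) / norm ?d"
      by (simp only: norm_divide norm_minus_cancel)
    also have "\<dots> \<le> (norm ?s + norm (S ?r (t k))) / norm ?d"
      by (intro divide_right_mono norm_triangle_ineq norm_ge_zero)
    also have "\<dots> \<le> (norm ?s + norm (S ?r (t k))) / \<delta>"
      using diag[of k] \<delta> d(1) by (intro divide_left_mono mult_pos_pos) auto
    also have "norm ?s \<le> \<delta> / 4 * (gn b * (1/2) ^ k)"
    proof -
      have "norm ?s \<le> (\<Sum>j\<in>{..<N} - {k}. gn b * (\<delta> / 8 * ((1/2) ^ j * (1/2) ^ k)))"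
      proof (rule sum_norm_le)
        fix j assume "j \<in> {..<N} - {k}"
        then show "norm (b j * u (m j) (t k)) \<le> gn b * (\<delta> / 8 * ((1/2) ^ j * (1/2) ^ k))"
          unfolding norm_mult using off[of j k] coord_le_gn[OF b] by (intro mult_mono) auto
      qed
      also have "\<dots> \<le> (\<Sum>j<N. gn b * (\<delta> / 8 * ((1/2) ^ j * (1/2) ^ k)))"
        using \<delta> by (intro sum_mono2) auto
      also have "\<dots> = \<delta> / 8 * gn b * (1/2) ^ k * (\<Sum>j<N. (1/2) ^ j)"
        by (simp add: sum_distrib_left mult_ac)
      also have "\<dots> \<le> \<delta> / 8 * gn b * (1/2) ^ k * 2"
        using \<delta> by (intro mult_left_mono sum_half_powers) auto
      finally show ?thesis by simp
    qed
    also have "norm (S ?r (t k)) \<le> e * \<delta>"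
    proof -
      have "norm (S ?r (t k)) \<le> gn (S ?r)" by (rule coord_le_gn[OF S_X[OF rX]])
      also have "\<dots> \<le> C * gn ?r" by (rule S_le[OF rX])
      also have "\<dots> \<le> (C + 1) * (e * \<delta> / (C + 1))"
        using n0[of N] C_nonneg by (intro mult_mono) (auto simp: N_def)
      finally show ?thesis using C_nonneg by simp
    qed
    also have "(\<delta> / 4 * (gn b * (1/2) ^ k) + e * \<delta>) / \<delta> = gn b / 4 * (1/2) ^ k + e"
      using \<delta> by (simp add: add_divide_distrib)
    finally show "norm (K b k) \<le> gn b / 4 * (1/2) ^ k + e"
      using \<delta> by (simp add: divide_right_mono)
  qed
  have K_small: "K b \<in> X \<and> gn (K b) \<le> gn b / 2" if b: "b \<in> X" for b
  proof -
    have "(\<Sum>k<N. norm (K b k)) \<le> gn b / 2" for N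
    proof -
      have "(\<Sum>k<N. norm (K b k)) \<le> (\<Sum>k<N. gn b / 4 * (1/2) ^ k)"
        by (intro sum_mono K_coord b)
      also have "\<dots> = gn b / 4 * (\<Sum>k<N. (1/2) ^ k)" by (simp only: sum_distrib_left)
      also have "\<dots> \<le> gn b / 4 * 2" by (intro mult_left_mono sum_half_powers) auto
      finally show ?thesis by simp
    qed
    then show ?thesis using gn_le_l1[of "gn b / 2" "K b"] by simp
  qed
  have K_lin: "linear_map garling_sp garling_sp K"
    unfolding linear_map_def
  proof (intro conjI ballI allI)
    show "K \<in> X \<rightarrow> X" using K_small by auto
    show "K (f + g) = K f + K g" if "f \<in> X" "g \<in> X" for f g
      unfolding K_def S_add[OF that] E_add by (rule add_diff_add)
    show "K (seq_scale d f) = seq_scale d (K f)" if "f \<in> X" for d f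
      unfolding K_def S_scale[OF that] E_scale
      by (auto simp: seq_scale_def fun_eq_iff right_diff_distrib)
  qed
  obtain L where L: "linear_map garling_sp garling_sp L" "\<And>f. f \<in> X \<Longrightarrow> gn (L f) \<le> 2 * gn f"
    "\<And>b. b \<in> X \<Longrightarrow> L (b - K b) = b"
    using neumann[OF K_lin] K_small by blast
  let ?Q = "\<lambda>f. L (E f)"
  have S_lin: "linear_map garling_sp garling_sp S"
    unfolding linear_map_def using S_X S_add S_scale by auto
  have Q_lin: "linear_map garling_sp garling_sp ?Q"
    unfolding linear_map_def
  proof (intro conjI ballI allI)
    show "?Q \<in> X \<rightarrow> X" using E_X L(1) by (auto simp: linear_map_def)
    show "?Q (f + g) = ?Q f + ?Q g" if "f \<in> X" "g \<in> X" for f g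
      unfolding E_add using E_X that L(1) unfolding linear_map_def by blast
    show "?Q (seq_scale d f) = seq_scale d (?Q f)" if "f \<in> X" for d f
      unfolding E_scale using E_X that L(1) unfolding linear_map_def by blast
  qed
  have Q_le: "gn (?Q f) \<le> (2 * (1 / \<delta>)) * gn f" if "f \<in> X" for f
    using L(2)[of "E f"] E_X[OF that] by simp
  have QS: "?Q (S b) = b" if "b \<in> X" for b
  proof -
    have "E (S b) = b - K b" by (simp add: K_def)
    then show ?thesis using L(3)[OF that] by simp
  qed
  have "S ` X \<subseteq> U ` X" unfolding S_def using spread_X(1)[OF mono(1)] by auto
  then show thesis
    using that range_complemented[OF S_lin Q_lin S_le C_nonneg Q_le QS]
    unfolding complemented_def by blast
qed

end

context garling begin

theorem garling_homogeneous:
  "complementably_homogeneous (garling_sp :: 'a::{real_normed_field,banach} seq_space)"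
  unfolding complementably_homogeneous_def
proof (intro allI impI)
  fix Y :: "(nat \<Rightarrow> 'a) set"
  assume Y: "closed_subspace garling_sp Y \<and> subspace_as_space garling_sp Y \<approx> garling_sp"
  then have sub: "Y \<subseteq> X" unfolding closed_subspace_iff by blast
  let ?Y = "subspace_as_space garling_sp Y"
  have car: "carrier ?Y = Y" and nrm: "nrm ?Y f = gn f" for f
    by (auto simp: subspace_as_space_def)
  obtain T U where T: "bounded_linear_map ?Y garling_sp T" and U: "bounded_linear_map garling_sp ?Y U"
    and TU: "\<And>g. g \<in> X \<Longrightarrow> T (U g) = g"
    using Y unfolding isomorphic_spaces_def by blast
  have U_lin: "linear_map garling_sp ?Y U" using U by (simp add: bounded_linear_map_def)
  have UY: "U g \<in> Y" if "g \<in> X" for g using U_lin that car by (auto simp: linear_map_def)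
  obtain C where C: "C \<ge> 0" "\<And>f. f \<in> X \<Longrightarrow> gn (U f) \<le> C * gn f"
    using bounded_linear_mapD[OF U] nrm gn_nonneg by metis
  obtain D where D: "D \<ge> 0" "\<And>f. f \<in> Y \<Longrightarrow> gn (T f) \<le> D * gn f"
    using bounded_linear_mapD[OF T] nrm car gn_nonneg by metis
  have low: "1 / (D + 1) * gn f \<le> gn (U f)" if "f \<in> X" for f
  proof -
    have "gn f \<le> D * gn (U f)" using D(2)[OF UY[OF that]] TU[OF that] by simp
    also have "\<dots> \<le> (D + 1) * gn (U f)" by (intro mult_right_mono) auto
    finally show ?thesis using D(1) by (simp add: field_simps)
  qed
  interpret e: garling_embedding w p U C "1 / (D + 1)"
  proof
    show "U f \<in> X" if "f \<in> X" for f using UY[OF that] sub by blast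
    show "U (f + g) = U f + U g" if "f \<in> X" "g \<in> X" for f g
      using U_lin that unfolding linear_map_def by blast
    show "U (seq_scale d f) = seq_scale d (U f)" if "f \<in> X" for d f
      using U_lin that unfolding linear_map_def by blast
  qed (use C D low in auto)
  obtain Z where Z: "Z \<subseteq> U ` X" "complemented garling_sp Z" "subspace_as_space garling_sp Z \<approx> garling_sp"
    using e.complemented_copy by blast
  have "closed_subspace garling_sp Z" using Z(2) unfolding complemented_def C_complemented_def by blast
  then show "\<exists>Z. closed_subspace garling_sp Z \<and> Z \<subseteq> Y \<and> subspace_as_space garling_sp Z \<approx> garling_sp \<and>
      complemented garling_sp Z"
    using Z UY by blast
qed

end

theorem corollary3p9:
  fixes w :: "nat \<Rightarrow> real" and p :: real
  assumes "w \<in> weights" and "1 \<le> p"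
  shows "(complementably_homogeneous (garling_space w p :: real seq_space) \<and>
          uniformly_complementably_saturated (garling_space w p :: real seq_space) (lp_space p :: real seq_space)) \<and>
         (complementably_homogeneous (garling_space w p :: complex seq_space) \<and>
          uniformly_complementably_saturated (garling_space w p :: complex seq_space) (lp_space p :: complex seq_space))"
proof -
  interpret garling w p using assms by unfold_locales
  show ?thesis by (intro conjI garling_homogeneous garling_saturated)
qed

end
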